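(* For $n \ge 1$ let $K = K_n$ be the transition matrix of the binary Burnside process on $C_2^n$, with stationary distribution $\pi = \pi_n$, and let $\chi_x^2(\ell)$ and $\chi_{\text{avg}}^2(\ell)$ be the chi-square distance started at $x \in C_2^n$ and the average chi-square distance after $\ell$ steps. Then the following hold. 1. For every $n \ge 1$ and every integer $\ell \ge 1$, $$\chi_{\text{avg}}^2(\ell) = \sum_{k=1}^{\lfloor n/2 \rfloor} \binom{n}{2k} \left(\frac{1}{2^{4k}} \binom{2k}{k}^2\right)^{2\ell}.$$ 2. Let $\varepsilon > 0$. If $\ell = \ell_n$ are nonnegative integers with $\ell_n \le (1-\varepsilon) \frac{\log 2}{2} \frac{n}{\log n}$, then $\chi_{\text{avg}}^2(\ell_n) \to \infty$ as $n \to \infty$. If $\ell = \ell_n$ are integers with $\ell_n \ge (1+\varepsilon)\frac{\log 2}{2} \frac{n}{\log n}$, then $\chi_{\text{avg}}^2(\ell_n) \to 0$ as $n \to \infty$. Therefore, there is a sequence of starting states $x^{(n)} \in C_2^n$ such that $\chi_{x^{(n)}}^2(\ell_n) \to \infty$ for all nonnegative integers $\ell_n \le (1 - \varepsilon)\frac{\log 2}{2} \frac{n}{\log n}$, while for all sequences of starting states $x^{(n)} \in C_2^n$ one has $\chi_{x^{(n)}}^2(\ell_n) \to 0$ for all integers $\ell_n \ge (1 + \varepsilon)\frac{\log 2}{2} \frac{n}{\log n}$. 3. Let $c \in (0,1)$ and let $x^{(n)} \in C_2^n$ be any sequence of states such that $cn \le |x^{(n)}| \le (1 - c)n$. Then $\chi_{x^{(n)}}^2(\ell)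 \to \infty$ for $\ell = \Theta_c\left(\frac{n}{\log n}\right)$; that is, there is a constant $\kappa > 0$ depending only on $c$ such that $\chi_{x^{(n)}}^2(\ell_n) \to \infty$ as $n \to \infty$ whenever $\ell_n$ are nonnegative integers with $\ell_n \le \kappa \frac{n}{\log n}$. 4. Let $y^{(n)} \in C_2^n$ be the state with $\lfloor \frac{n}{2} \rfloor$ zeros followed by $\lceil \frac{n}{2} \rceil$ ones. Then for every $\varepsilon > 0$, $\chi_{y^{(n)}}^2(\ell_n) \to \infty$ as $n \to \infty$ whenever $\ell_n$ are nonnegative integers with $\ell_n \le (1-\varepsilon) \frac{\log 2}{2} \frac{n}{\log n}$.
   Context: $C_2^n = \{0,1\}^n$ is the set of binary $n$-tuples, $|x|$ is the number of ones in $x$, and $\log$ is the natural logarithm. The symmetric group $S_n$ acts on $C_2^n$ by permuting coordinates. The binary Burnside process on $C_2^n$ is the Markov chain which from $x$ chooses $s$ uniformly from the stabilizer $G_x = \{s \in S_n : s \text{ fixes } x\}$ and then chooses $y$ uniformly from $\mathfrak{X}_s = \{y \in C_2^n : s \text{ fixes } y\}$; its transition matrix is $$K(x,y) = \frac{1}{|G_x|}\sum_{s \in G_x \cap G_y} \frac{1}{|\mathfrak{X}_s|}.$$ It is ergodic and reversible with stationary distribution $\pi(x) = \frac{1}{(n+1)\binom{n}{|x|}}$. Here $$\chi_x^2(\ell) = \sum_{y} \frac{(K^\ell(x,y) - \pi(y))^2}{\pi(y)}, \qquad \chi_{\text{avg}}^2(\ell) = \sum_x \pi(x)\chi_x^2(\ell).$$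 In the asymptotic statements $n \ge 2$. *)

theory Defs
  imports Complex_Main "HOL-Library.FuncSet" "HOL-Combinatorics.Permutations"
begin

text \<open>Binary tuples are extensional functions on the index set \<open>{..<n}\<close>
  (value \<open>undefined\<close> outside it), so the cube has exactly \<open>2 ^ n\<close> elements.\<close>

definition cube :: "nat \<Rightarrow> (nat \<Rightarrow> nat) set" where
  "cube n = {..<n} \<rightarrow>\<^sub>E {0, 1}"

definition weight :: "nat \<Rightarrow> (nat \<Rightarrow> nat) \<Rightarrow> nat" where
  "weight n x = card {i \<in> {..<n}. x i = 1}"

text \<open>The left action \<open>(s x)\<^sub>i = x\<^bsub>s\<^sup>-\<^sup>1(i)\<^esub>\<close>. Since a permutation of
  \<open>{..<n}\<close> fixes every \<open>i \<ge> n\<close>, it maps the cube to itself.\<close>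

definition perm_act :: "(nat \<Rightarrow> nat) \<Rightarrow> (nat \<Rightarrow> nat) \<Rightarrow> nat \<Rightarrow> nat" where
  "perm_act s x = x \<circ> inv s"

definition stabilizer :: "nat \<Rightarrow> (nat \<Rightarrow> nat) \<Rightarrow> (nat \<Rightarrow> nat) set" where
  "stabilizer n x = {s. s permutes {..<n} \<and> perm_act s x = x}"

definition fixed_points :: "nat \<Rightarrow> (nat \<Rightarrow> nat) \<Rightarrow> (nat \<Rightarrow> nat) set" where
  "fixed_points n s = {y \<in> cube n. perm_act s y = y}"

definition burnside_K :: "nat \<Rightarrow> (nat \<Rightarrow> nat) \<Rightarrow> (nat \<Rightarrow> nat) \<Rightarrow> real" where
  "burnside_K n x y =
     1 / real (card (stabilizer n x)) *
     (\<Sum>s \<in> stabilizer n x \<inter> stabilizer n y. 1 / real (card (fixed_points n s)))"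

text \<open>Powers of the transition matrix, whose rows and columns are indexed by the cube.\<close>

primrec burnside_pow :: "nat \<Rightarrow> nat \<Rightarrow> (nat \<Rightarrow> nat) \<Rightarrow> (nat \<Rightarrow> nat) \<Rightarrow> real" where
  "burnside_pow n 0 x y = (if x = y then 1 else 0)"
| "burnside_pow n (Suc l) x y = (\<Sum>z \<in> cube n. burnside_K n x z * burnside_pow n l z y)"

definition stat_dist :: "nat \<Rightarrow> (nat \<Rightarrow> nat) \<Rightarrow> real" where
  "stat_dist n x = 1 / (real (n + 1) * real (n choose weight n x))"

definition chi2 :: "nat \<Rightarrow> (nat \<Rightarrow> nat) \<Rightarrow> nat \<Rightarrow> real" where
  "chi2 n x l = (\<Sum>y \<in> cube n. (burnside_pow n l x y - stat_dist n y)\<^sup>2 / stat_dist n y)"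

definition chi2_avg :: "nat \<Rightarrow> nat \<Rightarrow> real" where
  "chi2_avg n l = (\<Sum>x \<in> cube n. stat_dist n x * chi2 n x l)"

definition half_state :: "nat \<Rightarrow> nat \<Rightarrow> nat" where
  "half_state n = (\<lambda>i \<in> {..<n}. if i < n div 2 then 0 else 1)"

end

theory Submission
  imports Defs "HOL-Computational_Algebra.Formal_Power_Series" "HOL-Real_Asymp.Real_Asymp"
begin

text \<open>Given the zero set and the one set of \<open>x\<close>, one step of the chain flips the coordinates in each of
  the two blocks by a coin whose bias is drawn from the arcsine law. Hence the image of a Walsh
  function \<open>\<chi>\<^sub>S\<close> depends on the coordinates in \<open>S\<close> only, so \<open>K\<close> is triangular with respect to
  inclusion of the index sets, with diagonal entry \<open>(C(2k,k) / 4\<^sup>k)\<^sup>2\<close> for \<open>|S| = 2 k\<close> and \<open>0\<close> for odd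
  \<open>|S|\<close>. By reversibility the average chi-square distance is the trace of \<open>K\<^sup>2\<^sup>l\<close> minus one. Each single
  distance is \<open>K\<^sup>2\<^sup>l(x,x) / \<pi>(x) - 1\<close>; it is at most \<open>n + 1\<close> times the average, and it is bounded
  below through \<open>K\<^sup>2\<^sup>l(x,x) \<ge> K(x,x)\<^sup>2\<^sup>l\<close>.\<close>

section \<open>Summing over colour-preserving permutations\<close>

text \<open>A permutation with \<open>c\<close> cycles fixes \<open>2^c\<close> tuples, and the sum
  of \<open>(1/2)^c\<close> over the permutations of \<open>m\<close> points is the rising factorial
  \<open>half_rising m\<close>. This is the source of the arcsine law: under it the mean of
  \<open>(1-p)^a p^b\<close> is \<open>half_rising a * half_rising b / fact (a + b)\<close>. No
  integral is formed; the identity \<open>half_rising_marginal\<close>, which allows a coordinate to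
  be forgotten, replaces the coin. Walsh functions are in general not eigenfunctions, and the lower
  terms in the image of one are never computed: triangularity and the diagonal already determine the
  trace of every power, which is all that the average distance needs. The constant
  \<open>ln 2 / 2\<close>: about \<open>2^(n-1)\<close> eigenvalues are nonzero, most of them of
  order \<open>1/n\<close>, so the average behaves like \<open>2^n n^(-2 l)\<close>, which turns
  from large to small near \<open>2 l ln n = n ln 2\<close>. A start at half weight shows the same
  balance: stationary mass near \<open>2^-n\<close> against a holding probability of order
  \<open>1/n\<close>. Factors \<open>n + 1\<close> are harmless because the margins on both sides
  outgrow every polynomial.\<close>

text \<open>\<open>F\<close> abstracts \<open>\<theta>\<close> to the number of cycles, by its
  behaviour when a point is inserted: the new point \<open>a\<close> is either a cycle of its own
  (factor \<open>\<theta>\<close>) or is spliced into the cycle of some \<open>b\<close> (no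
  factor). Preserving colours restricts \<open>b\<close> to the colour of \<open>a\<close>, so each
  insertion multiplies the sum by \<open>\<theta>\<close> plus the number of points already of that
  colour.\<close>

lemma sum_colour_preserving_permutations:
  fixes F :: "'a set \<Rightarrow> ('a \<Rightarrow> 'a) \<Rightarrow> real" and c :: "'a \<Rightarrow> 'b"
  assumes "finite A" and "finite C" and "c ` A \<subseteq> C"
    and empty: "F {} id = 1"
    and fix_new: "\<And>a B p. finite B \<Longrightarrow> a \<notin> B \<Longrightarrow> p permutes B \<Longrightarrow> F (insert a B) p = \<theta> * F B p"
    and link_new: "\<And>a b B p. finite B \<Longrightarrow> a \<notin> B \<Longrightarrow> b \<in> B \<Longrightarrow> p permutes B \<Longrightarrow>
      F (insert a B) (transpose a b \<circ> p) = F B p"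
  shows "(\<Sum>p | p permutes A \<and> (\<forall>i\<in>A. c (p i) = c i). F A p) =
    (\<Prod>k\<in>C. pochhammer \<theta> (card {i \<in> A. c i = k}))"
  using \<open>finite A\<close> \<open>c ` A \<subseteq> C\<close>
proof (induction A rule: finite_induct)
  case empty
  have "{p. p permutes {} \<and> (\<forall>i\<in>{}. c (p i) = c i)} = {id}" by auto
  then show ?case using \<open>F {} id = 1\<close> by (simp add: id_def)
next
  case (insert a A)
  let ?pres = "\<lambda>A p. \<forall>i\<in>A. c (p i) = c i"
  let ?G = "\<lambda>A p. if ?pres A p then F A p else 0"
  let ?Z = "\<Sum>p | p permutes A. ?G A p"
  have as_indicator: "(\<Sum>p | p permutes B \<and> ?pres B p. F B p) = (\<Sum>p | p permutes B. ?G B p)"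
    if "finite B" for B
    by (simp add: sum.inter_filter[symmetric] finite_permutations that)
  have fixed: "?G (insert a A) (transpose a a \<circ> q) = \<theta> * ?G A q" if q: "q permutes A" for q
  proof -
    have "q a = a" using q insert.hyps by (simp add: permutes_not_in)
    then have "?pres (insert a A) q \<longleftrightarrow> ?pres A q" by simp
    then show ?thesis using fix_new[OF insert.hyps q] by simp
  qed
  have linked: "?G (insert a A) (transpose a b \<circ> q) = (if c b = c a then ?G A q else 0)"
    if q: "q permutes A" and b: "b \<in> A" for q b
  proof -
    have qa: "q a = a" using q insert.hyps by (simp add: permutes_not_in)
    show ?thesis
    proof (cases "c b = c a")
      case True
      then have "c (transpose a b j) = c j" for j by (auto simp: transpose_def)
      then have "?pres (insert a A) (transpose a b \<circ> q) \<longleftrightarrow> ?pres A q"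
        using qa True by auto
      then show ?thesis using link_new[OF insert.hyps b q] True by simp
    next
      case False
      then show ?thesis using qa by auto
    qed
  qed
  have "(\<Sum>p | p permutes insert a A. ?G (insert a A) p) =
      (\<Sum>b\<in>insert a A. \<Sum>q | q permutes A. ?G (insert a A) (transpose a b \<circ> q))"
    by (rule sum_over_permutations_insert[OF insert.hyps])
  also have "\<dots> = (\<Sum>q | q permutes A. ?G (insert a A) (transpose a a \<circ> q)) +
      (\<Sum>b\<in>A. \<Sum>q | q permutes A. ?G (insert a A) (transpose a b \<circ> q))"
    by (rule sum.insert[OF insert.hyps])
  also have "(\<Sum>q | q permutes A. ?G (insert a A) (transpose a a \<circ> q)) = \<theta> * ?Z"
    unfolding sum_distrib_left by (rule sum.cong[OF refl], rule fixed) simp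
  also have "(\<Sum>b\<in>A. \<Sum>q | q permutes A. ?G (insert a A) (transpose a b \<circ> q)) =
      (\<Sum>b\<in>A. if c b = c a then ?Z else 0)"
  proof (rule sum.cong[OF refl])
    fix b assume b: "b \<in> A"
    have "(\<Sum>q | q permutes A. ?G (insert a A) (transpose a b \<circ> q)) =
        (\<Sum>q | q permutes A. if c b = c a then ?G A q else 0)"
      by (rule sum.cong[OF refl], rule linked) (use b in simp_all)
    then show "(\<Sum>q | q permutes A. ?G (insert a A) (transpose a b \<circ> q)) =
        (if c b = c a then ?Z else 0)" by simp
  qed
  also have "\<dots> = real (card {b \<in> A. c b = c a}) * ?Z"
    by (simp add: sum.inter_filter[symmetric] insert.hyps)
  finally have rec: "(\<Sum>p | p permutes insert a A. ?G (insert a A) p) =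
      (\<theta> + real (card {b \<in> A. c b = c a})) * ?Z" by (simp add: algebra_simps)
  have IH: "?Z = (\<Prod>k\<in>C. pochhammer \<theta> (card {i \<in> A. c i = k}))"
    using insert by (simp add: as_indicator)
  have ca: "c a \<in> C" using insert.prems by simp
  have "{i \<in> insert a A. c i = c a} = insert a {i \<in> A. c i = c a}" by auto
  then have same: "card {i \<in> insert a A. c i = c a} = Suc (card {i \<in> A. c i = c a})"
    using insert.hyps by simp
  have other: "{i \<in> insert a A. c i = k} = {i \<in> A. c i = k}" if "k \<in> C - {c a}" for k
    using that by auto
  have "(\<Prod>k\<in>C. pochhammer \<theta> (card {i \<in> insert a A. c i = k})) =
      pochhammer \<theta> (Suc (card {i \<in> A. c i = c a})) *
      (\<Prod>k\<in>C - {c a}. pochhammer \<theta> (card {i \<in> insert a A. c i = k}))"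
    by (simp only: prod.remove[OF \<open>finite C\<close> ca] same)
  also have "(\<Prod>k\<in>C - {c a}. pochhammer \<theta> (card {i \<in> insert a A. c i = k})) =
      (\<Prod>k\<in>C - {c a}. pochhammer \<theta> (card {i \<in> A. c i = k}))"
    by (rule prod.cong[OF refl]) (simp only: other)
  also have "pochhammer \<theta> (Suc (card {i \<in> A. c i = c a})) * \<dots> =
      (\<theta> + real (card {b \<in> A. c b = c a})) * ?Z"
    unfolding IH by (simp add: prod.remove[OF \<open>finite C\<close> ca] pochhammer_Suc)
  finally show ?case
    unfolding as_indicator[OF finite.insertI[OF insert.hyps(1)]] using rec by (simp only:)
qed

section \<open>Counting fixed tuples through unions of cycles\<close>

text \<open>For a permutation \<open>s\<close> of \<open>A\<close> these are the unions of cycles of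
  \<open>s\<close>, so their number is \<open>2\<close> to the number of cycles, without cycles
  being formalised. They are also the sets of ones of the tuples fixed by \<open>s\<close>.\<close>

definition invariant_subsets :: "'a set \<Rightarrow> ('a \<Rightarrow> 'a) \<Rightarrow> 'a set set" where
  "invariant_subsets A s = {Y \<in> Pow A. \<forall>i\<in>A. s i \<in> Y \<longleftrightarrow> i \<in> Y}"

text \<open>A new fixed point may be put into an invariant set or left out, independently of the
  rest.\<close>

lemma card_invariant_subsets_fix_new:
  assumes "finite B" "a \<notin> B" "p permutes B"
  shows "card (invariant_subsets (insert a B) p) = 2 * card (invariant_subsets B p)"
proof -
  have pB: "p i \<in> B" if "i \<in> B" for i using assms that by (auto simp: permutes_in_image)
  have pa: "p a = a" using assms by (auto simp: permutes_not_in)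
  have eq: "invariant_subsets (insert a B) p =
      invariant_subsets B p \<union> insert a ` invariant_subsets B p"
    (is "?L = ?R")
  proof
    show "?L \<subseteq> ?R"
    proof
      fix Y assume Y: "Y \<in> ?L"
      show "Y \<in> ?R"
      proof (cases "a \<in> Y")
        case True
        have "Y - {a} \<in> invariant_subsets B p"
          using Y pa pB \<open>a \<notin> B\<close> unfolding invariant_subsets_def by fastforce
        moreover have "Y = insert a (Y - {a})" using True by auto
        ultimately show ?thesis by blast
      next
        case False
        then show ?thesis using Y by (auto simp: invariant_subsets_def)
      qed
    qed
    show "?R \<subseteq> ?L"
    proof
      fix Y assume "Y \<in> ?R"
      then obtain Z where "Z \<in> invariant_subsets B p" "Y = Z \<or> Y = insert a Z" by auto
      then show "Y \<in> ?L" using pa pB \<open>a \<notin> B\<close> unfolding invariant_subsets_def by fastforce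
    qed
  qed
  have sub: "invariant_subsets B p \<subseteq> Pow B" by (auto simp: invariant_subsets_def)
  then have fin: "finite (invariant_subsets B p)" using \<open>finite B\<close> finite_subset by blast
  have "inj_on (insert a) (invariant_subsets B p)"
    using sub \<open>a \<notin> B\<close> unfolding inj_on_def by (metis PowD insert_ident subset_eq)
  moreover have "invariant_subsets B p \<inter> insert a ` invariant_subsets B p = {}"
    using sub \<open>a \<notin> B\<close> by auto
  ultimately show ?thesis unfolding eq using fin by (simp add: card_Un_disjoint card_image)
qed

text \<open>The new permutation sends \<open>a\<close> to \<open>b\<close>, so membership of
  \<open>a\<close> is forced by that of \<open>b\<close>; deleting \<open>a\<close> is inverse to
  adding it exactly when \<open>b\<close> is present.\<close>

lemma card_invariant_subsets_link_new:
  assumes "finite B" "a \<notin> B" "b \<in> B" "p permutes B"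
  shows "card (invariant_subsets (insert a B) (transpose a b \<circ> p)) = card (invariant_subsets B p)"
proof -
  let ?s = "transpose a b \<circ> p"
  let ?f = "\<lambda>Y. if b \<in> Y then insert a Y else Y"
  have pB: "p i \<in> B" if "i \<in> B" for i using assms that by (auto simp: permutes_in_image)
  have sa: "?s a = b" using assms by (simp add: permutes_not_in)
  have f_in: "?f Y \<in> invariant_subsets (insert a B) ?s" if "Y \<in> invariant_subsets B p" for Y
    using that assms(2,3) pB sa unfolding invariant_subsets_def
    by (auto simp: transpose_def split: if_splits)
  have g_in: "Y - {a} \<in> invariant_subsets B p" and fg: "?f (Y - {a}) = Y"
    if Y: "Y \<in> invariant_subsets (insert a B) ?s" for Y
  proof -
    have ab: "b \<in> Y \<longleftrightarrow> a \<in> Y"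
      using Y sa unfolding invariant_subsets_def by auto
    have "p i \<in> Y \<longleftrightarrow> i \<in> Y" if "i \<in> B" for i
    proof -
      have "?s i \<in> Y \<longleftrightarrow> i \<in> Y" using Y that unfolding invariant_subsets_def by blast
      then show ?thesis using ab by (auto simp: transpose_def split: if_splits)
    qed
    then show "Y - {a} \<in> invariant_subsets B p"
      using Y pB \<open>a \<notin> B\<close> unfolding invariant_subsets_def by auto
    show "?f (Y - {a}) = Y" using ab \<open>a \<notin> B\<close> \<open>b \<in> B\<close> by auto
  qed
  have gf: "?f Y - {a} = Y" if "Y \<in> invariant_subsets B p" for Y
    using that \<open>a \<notin> B\<close> unfolding invariant_subsets_def by auto
  have "bij_betw ?f (invariant_subsets B p) (invariant_subsets (insert a B) ?s)"
    by (rule bij_betw_byWitness[where f' = "\<lambda>Y. Y - {a}"])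
      (intro ballI image_subsetI gf fg f_in g_in; assumption)+
  then show ?thesis by (simp add: bij_betw_same_card)
qed

abbreviation half_rising :: "nat \<Rightarrow> real" where
  "half_rising \<equiv> pochhammer (1 / 2)"

lemma sum_colour_preserving_inverse_invariant:
  fixes c :: "'a \<Rightarrow> 'b"
  assumes "finite A" "finite C" "c ` A \<subseteq> C"
  shows "(\<Sum>p | p permutes A \<and> (\<forall>i\<in>A. c (p i) = c i). 1 / real (card (invariant_subsets A p))) =
    (\<Prod>k\<in>C. half_rising (card {i \<in> A. c i = k}))"
proof (rule sum_colour_preserving_permutations[OF assms])
  have "invariant_subsets {} id = {{} :: 'a set}" by (auto simp: invariant_subsets_def)
  then show "1 / real (card (invariant_subsets {} (id :: 'a \<Rightarrow> 'a))) = 1" by simp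
qed (simp_all add: card_invariant_subsets_fix_new card_invariant_subsets_link_new del: o_apply)

lemma card_colour_preserving:
  fixes c :: "'a \<Rightarrow> 'b"
  assumes "finite A" "finite C" "c ` A \<subseteq> C"
  shows "real (card {p. p permutes A \<and> (\<forall>i\<in>A. c (p i) = c i)}) =
    (\<Prod>k\<in>C. fact (card {i \<in> A. c i = k}))"
  using sum_colour_preserving_permutations[OF assms, of "\<lambda>_ _. 1" 1]
  by (simp add: pochhammer_fact)

section \<open>The transition kernel on subsets\<close>

text \<open>A tuple is replaced by the set of its ones.\<close>

definition burnside_kernel :: "'a set \<Rightarrow> 'a set \<Rightarrow> 'a set \<Rightarrow> real" where
  "burnside_kernel A X Y =
     half_rising (card (A - X - Y)) * half_rising (card ((A - X) \<inter> Y)) / fact (card (A - X)) *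
     (half_rising (card (A \<inter> X - Y)) * half_rising (card (A \<inter> X \<inter> Y)) / fact (card (A \<inter> X)))"

definition ones :: "nat \<Rightarrow> (nat \<Rightarrow> nat) \<Rightarrow> nat set" where
  "ones n x = {i \<in> {..<n}. x i = 1}"

lemma ones_subset: "ones n x \<subseteq> {..<n}"
  by (auto simp: ones_def)

lemma bij_betw_ones: "bij_betw (ones n) (cube n) (Pow {..<n})"
proof (rule bij_betw_byWitness[where f' = "\<lambda>X. \<lambda>i\<in>{..<n}. if i \<in> X then 1 else 0"])
  show "\<forall>x\<in>cube n. (\<lambda>i\<in>{..<n}. if i \<in> ones n x then 1 else 0) = x"
  proof
    fix x assume x: "x \<in> cube n"
    show "(\<lambda>i\<in>{..<n}. if i \<in> ones n x then 1 else 0) = x"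
    proof
      fix i
      show "(\<lambda>i\<in>{..<n}. if i \<in> ones n x then 1 else 0) i = x i"
        using PiE_mem[OF x[unfolded cube_def], of i] PiE_arb[OF x[unfolded cube_def], of i]
        by (auto simp: ones_def)
    qed
  qed
qed (auto simp: ones_def cube_def split: if_splits)

lemma stabilizer_iff:
  assumes x: "x \<in> cube n"
  shows "s \<in> stabilizer n x \<longleftrightarrow>
    s permutes {..<n} \<and> (\<forall>i\<in>{..<n}. s i \<in> ones n x \<longleftrightarrow> i \<in> ones n x)"
proof (cases "s permutes {..<n}")
  case True
  have "x \<circ> inv s = x \<longleftrightarrow> x \<circ> s = x"
    using permutes_inv_o[OF True] by (metis comp_assoc comp_id)
  also have "\<dots> \<longleftrightarrow> (\<forall>i. x (s i) = x i)" by (auto simp: fun_eq_iff)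
  also have "\<dots> \<longleftrightarrow> (\<forall>i\<in>{..<n}. x (s i) = x i)"
    using True by (metis permutes_not_in)
  also have "\<dots> \<longleftrightarrow> (\<forall>i\<in>{..<n}. s i \<in> ones n x \<longleftrightarrow> i \<in> ones n x)"
  proof (rule ball_cong[OF refl])
    fix i assume i: "i \<in> {..<n}"
    then have si: "s i \<in> {..<n}" using True by (simp only: permutes_in_image)
    show "x (s i) = x i \<longleftrightarrow> (s i \<in> ones n x \<longleftrightarrow> i \<in> ones n x)"
      using PiE_mem[OF x[unfolded cube_def] i] PiE_mem[OF x[unfolded cube_def] si] i si
      by (auto simp: ones_def)
  qed
  finally show ?thesis using True by (simp add: stabilizer_def perm_act_def)
qed (simp add: stabilizer_def)

lemma card_fixed_points:
  assumes s: "s permutes {..<n}"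
  shows "card (fixed_points n s) = card (invariant_subsets {..<n} s)"
proof -
  have "fixed_points n s = {y \<in> cube n. s \<in> stabilizer n y}"
    using s by (auto simp: fixed_points_def stabilizer_def)
  also have "\<dots> = {y \<in> cube n. ones n y \<in> invariant_subsets {..<n} s}"
    using s ones_subset[of n] by (auto simp: stabilizer_iff invariant_subsets_def)
  finally have fp: "fixed_points n s = {y \<in> cube n. ones n y \<in> invariant_subsets {..<n} s}" .
  have "invariant_subsets {..<n} s \<subseteq> ones n ` cube n"
    unfolding bij_betw_imp_surj_on[OF bij_betw_ones] by (auto simp: invariant_subsets_def)
  then have "ones n ` fixed_points n s = invariant_subsets {..<n} s"
    unfolding fp by blast
  moreover have "inj_on (ones n) (fixed_points n s)"
    using bij_betw_imp_inj_on[OF bij_betw_ones[of n]]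
    by (rule inj_on_subset) (auto simp: fixed_points_def)
  ultimately show ?thesis by (metis card_image)
qed

lemma card_stabilizer:
  assumes x: "x \<in> cube n"
  shows "real (card (stabilizer n x)) = fact (card ({..<n} - ones n x)) * fact (card (ones n x))"
proof -
  have "stabilizer n x =
      {s. s permutes {..<n} \<and> (\<forall>i\<in>{..<n}. (s i \<in> ones n x) = (i \<in> ones n x))}"
    using stabilizer_iff[OF x] by blast
  then have "real (card (stabilizer n x)) =
      (\<Prod>k\<in>UNIV. fact (card {i \<in> {..<n}. (i \<in> ones n x) = k}))"
    using card_colour_preserving[of "{..<n}" UNIV "\<lambda>i. i \<in> ones n x"] by simp
  moreover have "{i \<in> {..<n}. i \<in> ones n x} = ones n x" "{i \<in> {..<n}. i \<notin> ones n x} = {..<n} - ones n x"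
    using ones_subset[of n x] by auto
  ultimately show ?thesis by (simp add: UNIV_bool)
qed

text \<open>Lying in both stabilizers means preserving the four-valued colour \<open>?c\<close>. The
  cycle sum therefore yields one \<open>half_rising\<close> per colour class, and the order of the
  stabilizer of \<open>x\<close> supplies the two factorials.\<close>

lemma burnside_K_eq_kernel:
  assumes x: "x \<in> cube n" and y: "y \<in> cube n"
  shows "burnside_K n x y = burnside_kernel {..<n} (ones n x) (ones n y)"
proof -
  let ?X = "ones n x" and ?Y = "ones n y"
  let ?c = "\<lambda>i. (i \<in> ?X, i \<in> ?Y)"
  have both: "stabilizer n x \<inter> stabilizer n y =
      {s. s permutes {..<n} \<and> (\<forall>i\<in>{..<n}. ?c (s i) = ?c i)}"
    by (auto simp: stabilizer_iff[OF x] stabilizer_iff[OF y])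
  have "(\<Sum>s \<in> stabilizer n x \<inter> stabilizer n y. 1 / real (card (fixed_points n s))) =
      (\<Sum>s | s permutes {..<n} \<and> (\<forall>i\<in>{..<n}. ?c (s i) = ?c i).
        1 / real (card (invariant_subsets {..<n} s)))"
    unfolding both by (rule sum.cong[OF refl]) (simp add: card_fixed_points)
  also have "\<dots> = (\<Prod>k\<in>UNIV \<times> UNIV. half_rising (card {i \<in> {..<n}. ?c i = k}))"
    by (rule sum_colour_preserving_inverse_invariant) simp_all
  also have "\<dots> = (\<Prod>k\<in>UNIV. \<Prod>k'\<in>UNIV. half_rising (card {i \<in> {..<n}. ?c i = (k, k')}))"
    by (simp add: prod.cartesian_product case_prod_unfold prod_eq_iff)
  also have "\<dots> = half_rising (card ({..<n} - ?X - ?Y)) * half_rising (card (({..<n} - ?X) \<inter> ?Y)) *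
      (half_rising (card ({..<n} \<inter> ?X - ?Y)) * half_rising (card ({..<n} \<inter> ?X \<inter> ?Y)))"
  proof -
    have "{i \<in> {..<n}. ?c i = (False, False)} = {..<n} - ?X - ?Y"
      "{i \<in> {..<n}. ?c i = (False, True)} = ({..<n} - ?X) \<inter> ?Y"
      "{i \<in> {..<n}. ?c i = (True, False)} = {..<n} \<inter> ?X - ?Y"
      "{i \<in> {..<n}. ?c i = (True, True)} = {..<n} \<inter> ?X \<inter> ?Y" by auto
    then show ?thesis by (simp only: UNIV_bool) simp
  qed
  finally show ?thesis
    using ones_subset[of n x]
    by (simp add: burnside_K_def burnside_kernel_def card_stabilizer[OF x] Int_absorb1)
qed

section \<open>Moments of the arcsine law\<close>

lemma half_rising_over_fact: "half_rising k / fact k = real ((2 * k) choose k) / 4 ^ k"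
proof -
  have "real ((2 * k) choose k) = fact (2 * k) / (fact k * fact k)"
    by (simp add: binomial_fact)
  also have "\<dots> = 4 ^ k * half_rising k / fact k"
    by (simp add: fact_double power_mult)
  finally show ?thesis by simp
qed

text \<open>With \<open>A\<close> the series of \<open>(1 - x)^(-1/2)\<close>, this compares the
  coefficients of \<open>A(-x) A(x)\<close> and \<open>A(x^2)\<close>, both equal to
  \<open>(1 - x^2)^(-1/2)\<close>. Probabilistically it is the moment of order \<open>r\<close> of
  \<open>1 - 2 p\<close> for an arcsine \<open>p\<close>.\<close>

lemma convolution_half_rising_alternating:
  "(\<Sum>j\<le>r. (-1) ^ j * (half_rising j / fact j) * (half_rising (r - j) / fact (r - j))) =
    (if even r then half_rising (r div 2) / fact (r div 2) else 0)"
proof -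
  define A :: "real fps" where "A = Abs_fps (\<lambda>j. half_rising j / fact j)"
  have A_sq: "(1 - fps_X) * (A * A) = 1"
  proof -
    have "fps_nth (A * A) m = 1" for m
    proof -
      have "fps_nth (A * A) m = (\<Sum>j\<le>m. real (m choose j) * half_rising j * half_rising (m - j)) / fact m"
        by (simp add: fps_mult_nth A_def atLeast0AtMost sum_divide_distrib binomial_fact)
      \<comment> \<open>Chu-Vandermonde for \<open>1/2 + 1/2 = 1\<close>, where the rising factorial
        of \<open>1\<close> is \<open>fact m\<close>.\<close>
      also have "(\<Sum>j\<le>m. real (m choose j) * half_rising j * half_rising (m - j)) = fact m"
        using pochhammer_binomial_sum[of "1/2 :: real" "1/2" m] by (simp flip: pochhammer_fact)
      also have "fact m / fact m = (1::real)" by simp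
      finally show ?thesis .
    qed
    then have "A * A = Abs_fps (\<lambda>_. 1)" by (simp add: fps_eq_iff)
    then show ?thesis by (simp add: fps_eq_iff left_diff_distrib)
  qed
  define B where "B = A oo (- fps_X)"
  define G where "G = A oo (fps_X ^ 2)"
  have B_sq: "(1 + fps_X) * (B * B) = 1"
    using arg_cong[OF A_sq, of "\<lambda>f. f oo (- fps_X)"]
    by (simp add: fps_compose_mult_distrib fps_compose_sub_distrib B_def)
  have G_sq: "(1 - fps_X ^ 2) * (G * G) = 1"
    using arg_cong[OF A_sq, of "\<lambda>f. f oo (fps_X ^ 2)"]
    by (simp add: fps_compose_mult_distrib fps_compose_sub_distrib G_def)
  have "(1 - fps_X ^ 2) * ((B * A) * (B * A)) =
      ((1 + fps_X) * (B * B)) * ((1 - fps_X) * (A * A))"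
    by (simp add: power2_eq_square algebra_simps)
  also have "\<dots> = (1 - fps_X ^ 2) * (G * G)" using A_sq B_sq G_sq by simp
  finally have "(1 - fps_X ^ 2) * ((B * A) * (B * A) - G * G) = 0"
    by (simp add: right_diff_distrib)
  moreover have "1 - fps_X ^ 2 \<noteq> (0 :: real fps)"
    using G_sq by (metis mult_zero_left zero_neq_one)
  ultimately have "(B * A) * (B * A) - G * G = 0" by (metis mult_eq_0_iff)
  \<comment> \<open>Equal squares leave a sign open; it is decided by the constant term of
    \<open>B * A + G\<close>, which is \<open>2\<close> and not \<open>0\<close>.\<close>
  then have "(B * A - G) * (B * A + G) = 0"
    by (simp add: algebra_simps)
  moreover have "fps_nth (B * A + G) 0 = 2" by (simp add: A_def B_def G_def)
  then have "B * A + G \<noteq> 0" by (metis fps_zero_nth zero_neq_numeral)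
  ultimately have "B * A = G" by simp
  then have "fps_nth (B * A) r = fps_nth G r" by simp
  moreover have "fps_nth (B * A) r =
      (\<Sum>j\<le>r. (-1) ^ j * (half_rising j / fact j) * (half_rising (r - j) / fact (r - j)))"
    by (simp add: fps_mult_nth B_def fps_compose_uminus' A_def atLeast0AtMost)
  moreover have "fps_nth G r = (if even r then half_rising (r div 2) / fact (r div 2) else 0)"
  proof -
    have "fps_nth G r = (\<Sum>i\<in>{0..r}. if i = r div 2 then
        if even r then half_rising (r div 2) / fact (r div 2) else 0 else 0)"
      unfolding G_def fps_compose_nth
      by (rule sum.cong) (auto simp: A_def power_mult[symmetric])
    then show ?thesis by simp
  qed
  ultimately show ?thesis by simp
qed

lemma sum_Pow_card:
  fixes f :: "nat \<Rightarrow> 'b::comm_semiring_1"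
  assumes "finite A"
  shows "(\<Sum>X\<in>Pow A. f (card X)) = (\<Sum>j\<le>card A. of_nat (card A choose j) * f j)"
proof -
  have "(\<Sum>X\<in>Pow A. f (card X)) = (\<Sum>j\<le>card A. \<Sum>X\<in>{X \<in> Pow A. card X = j}. f (card X))"
    using assms by (intro sum.group[symmetric]) (auto intro: card_mono)
  also have "\<dots> = (\<Sum>j\<le>card A. \<Sum>X\<in>{X. X \<subseteq> A \<and> card X = j}. f j)"
    by (intro sum.cong) auto
  also have "\<dots> = (\<Sum>j\<le>card A. of_nat (card A choose j) * f j)"
    using assms by (simp add: n_subsets)
  finally show ?thesis .
qed

text \<open>Moment of order \<open>r\<close> of \<open>1 - 2 p\<close> for arcsine \<open>p\<close>,
  that is, of the cosine of a uniform angle; odd moments vanish by symmetry.\<close>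

definition arcsine_moment :: "nat \<Rightarrow> real" where
  "arcsine_moment r = (if even r then half_rising (r div 2) / fact (r div 2) else 0)"

definition burnside_eigenvalue :: "nat \<Rightarrow> real" where
  "burnside_eigenvalue m =
     (if even m then (half_rising (m div 2) / fact (m div 2))\<^sup>2 else 0)"

lemma burnside_eigenvalue_even:
  "burnside_eigenvalue (2 * k) = 1 / 2 ^ (4 * k) * (real ((2 * k) choose k))\<^sup>2"
  by (simp add: burnside_eigenvalue_def half_rising_over_fact power_divide power2_eq_square
      power_mult flip: power_mult_distrib)

text \<open>This is the mean of a product of \<open>card R\<close> signs flipped by a common arcsine
  coin; given the coin, the signs are independent with mean \<open>1 - 2 p\<close>.\<close>

lemma sum_signed_Pow_half_rising:
  assumes "finite R"
  shows "(\<Sum>Y\<in>Pow R. (-1) ^ card Y * (half_rising (card (R - Y)) * half_rising (card Y) / fact (card R))) =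
    arcsine_moment (card R)"
proof -
  have "(\<Sum>Y\<in>Pow R. (-1) ^ card Y * (half_rising (card (R - Y)) * half_rising (card Y) / fact (card R))) =
      (\<Sum>Y\<in>Pow R. (-1) ^ card Y * (half_rising (card R - card Y) * half_rising (card Y) / fact (card R)))"
    using assms by (intro sum.cong) (auto simp: card_Diff_subset finite_subset)
  also have "\<dots> = (\<Sum>j\<le>card R. real (card R choose j) *
      ((-1) ^ j * (half_rising (card R - j) * half_rising j / fact (card R))))"
    by (rule sum_Pow_card[OF assms])
  also have "\<dots> = (\<Sum>j\<le>card R. (-1) ^ j * (half_rising j / fact j) *
      (half_rising (card R - j) / fact (card R - j)))"
    by (intro sum.cong) (simp_all add: binomial_fact)
  finally show ?thesis unfolding convolution_half_rising_alternating arcsine_moment_def .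
qed

text \<open>The left side is the moment of order \<open>m = card S\<close> of
  \<open>cos a - cos b\<close> for independent uniform angles. Writing the difference as
  \<open>-2 sin((a+b)/2) sin((a-b)/2)\<close> explains the factor \<open>2^m\<close> and, for even
  \<open>m\<close>, the square. The proof is combinatorial: each surviving term is a fixed moment
  times a squared binomial coefficient.\<close>

lemma sum_signed_Pow_arcsine_moment:
  assumes "finite S"
  shows "(\<Sum>X\<in>Pow S. (-1) ^ card X * (arcsine_moment (card (S - X)) * arcsine_moment (card X))) =
    2 ^ card S * burnside_eigenvalue (card S)"
proof -
  define m where "m = card S"
  let ?f = "\<lambda>j. real (m choose j) * ((-1) ^ j * (arcsine_moment (m - j) * arcsine_moment j))"
  have "(\<Sum>X\<in>Pow S. (-1) ^ card X * (arcsine_moment (card (S - X)) * arcsine_moment (card X))) =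
      (\<Sum>X\<in>Pow S. (-1) ^ card X * (arcsine_moment (m - card X) * arcsine_moment (card X)))"
    using assms by (intro sum.cong) (auto simp: card_Diff_subset finite_subset m_def)
  also have "\<dots> = (\<Sum>j\<le>m. ?f j)"
    unfolding m_def by (rule sum_Pow_card[OF assms])
  also have "\<dots> = 2 ^ m * burnside_eigenvalue m"
  proof (cases "even m")
    case False
    then have "?f j = 0" if "j \<le> m" for j
      using that by (cases "even j") (auto simp: arcsine_moment_def)
    then have "(\<Sum>j\<le>m. ?f j) = 0" by (intro sum.neutral) blast
    then show ?thesis using False by (simp add: burnside_eigenvalue_def)
  next
    case True
    then obtain k where k: "m = 2 * k" by blast
    have "(\<Sum>j\<le>m. ?f j) = (\<Sum>j\<in>(\<lambda>i. 2 * i) ` {..k}. ?f j)"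
    proof (rule sum.mono_neutral_right)
      show "\<forall>j\<in>{..m} - (\<lambda>i. 2 * i) ` {..k}. ?f j = 0"
        by (auto simp: k arcsine_moment_def image_iff elim!: evenE)
    qed (auto simp: k)
    also have "\<dots> = (\<Sum>i\<le>k. ?f (2 * i))" by (simp add: sum.reindex inj_on_def)
    also have "\<dots> = (\<Sum>i\<le>k. half_rising k / fact k * real ((k choose i)\<^sup>2))"
    proof (rule sum.cong[OF refl])
      fix i assume "i \<in> {..k}"
      then have i: "i \<le> k" by simp
      have d: "2 * k - 2 * i = 2 * (k - i)" by simp
      have "?f (2 * i) = real ((2 * k) choose (2 * i)) *
          (half_rising (k - i) / fact (k - i) * (half_rising i / fact i))"
        by (simp add: k arcsine_moment_def d)
      also have "\<dots> = fact (2 * k) / (fact (2 * i) * fact (2 * (k - i))) *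
          (half_rising (k - i) / fact (k - i) * (half_rising i / fact i))"
        using i by (simp add: binomial_fact d)
      \<comment> \<open>By \<open>fact_double\<close>, \<open>fact (2 * j)\<close> is
        \<open>4^j * half_rising j * fact j\<close>: the rising factorials of \<open>i\<close> and
        \<open>k - i\<close> cancel, and so do the powers of \<open>4\<close>.\<close>
      also have "\<dots> = half_rising k / fact k * (fact k / (fact i * fact (k - i)))\<^sup>2"
      proof -
        have nz: "half_rising j \<noteq> 0" for j by (simp add: pochhammer_eq_0_iff)
        have "(4::real) ^ k = 4 ^ i * 4 ^ (k - i)" using i by (simp flip: power_add)
        moreover have "(2::real) ^ (2 * j) = 4 ^ j" for j by (simp add: power_mult)
        ultimately show ?thesis
          using nz[of i] nz[of "k - i"] unfolding fact_double
          by (simp add: power2_eq_square field_simps)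
      qed
      also have "(fact k / (fact i * fact (k - i)))\<^sup>2 = real ((k choose i)\<^sup>2)"
        using i by (simp add: binomial_fact)
      finally show "?f (2 * i) = half_rising k / fact k * real ((k choose i)\<^sup>2)" .
    qed
    also have "\<dots> = half_rising k / fact k * real ((2 * k) choose k)"
      unfolding sum_distrib_left[symmetric] of_nat_sum[symmetric] choose_square_sum ..
    also have "\<dots> = 2 ^ m * burnside_eigenvalue m"
      unfolding k burnside_eigenvalue_def half_rising_over_fact
      by (simp add: power_mult power2_eq_square)
    finally show ?thesis .
  qed
  finally show ?thesis by (simp add: m_def)
qed

section \<open>Triangularity in the Walsh basis\<close>

definition walsh :: "'a set \<Rightarrow> 'a set \<Rightarrow> real" where
  "walsh S X = (\<Prod>i\<in>S. if i \<in> X then -1 else 1)"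

lemma walsh_subset: "finite S \<Longrightarrow> X \<subseteq> S \<Longrightarrow> walsh S X = (-1) ^ card X"
  by (simp add: walsh_def prod.If_cases Int_absorb1)

lemma walsh_empty [simp]: "walsh {} X = 1"
  by (simp add: walsh_def)

text \<open>Both sides are \<open>-1\<close> to the size of \<open>S \<inter> X\<close>. This turns
  orthogonality summed over index sets into orthogonality summed over points of the cube.\<close>

lemma walsh_commute:
  assumes "finite A" "S \<subseteq> A" "X \<subseteq> A"
  shows "walsh S X = walsh X S"
proof -
  have "finite S" "finite X" using assms finite_subset by blast+
  then show ?thesis by (simp add: walsh_def prod.If_cases Int_commute)
qed

text \<open>The sum is the expansion of a product over \<open>A\<close> of factors \<open>2\<close>
  or \<open>0\<close>; a coordinate on which \<open>X\<close> and \<open>Y\<close> differ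
  contributes \<open>0\<close>.\<close>

lemma walsh_orthogonal:
  assumes "finite A" "X \<subseteq> A" "Y \<subseteq> A"
  shows "(\<Sum>S\<in>Pow A. walsh S X * walsh S Y) = (if X = Y then 2 ^ card A else 0)"
proof -
  let ?f = "\<lambda>i. if i \<in> X \<longleftrightarrow> i \<in> Y then 1 else - 1 :: real"
  have "(\<Sum>S\<in>Pow A. walsh S X * walsh S Y) = (\<Sum>S\<in>Pow A. prod ?f S * prod (\<lambda>_. 1) (A - S))"
    by (auto simp: walsh_def simp flip: prod.distrib intro!: sum.cong prod.cong)
  also have "\<dots> = (\<Prod>i\<in>A. ?f i + 1)" by (rule prod_add[OF \<open>finite A\<close>, symmetric])
  also have "\<dots> = (if X = Y then 2 ^ card A else 0)"
  proof (cases "X = Y")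
    case False
    then obtain i where "i \<in> A" "(i \<in> X) \<noteq> (i \<in> Y)" using assms by blast
    then have "\<exists>i\<in>A. ?f i + 1 = 0" by auto
    then show ?thesis using False prod_zero[OF \<open>finite A\<close>] by simp
  qed simp
  finally show ?thesis .
qed

text \<open>It comes down to \<open>(i + 1/2) + (j + 1/2) = i + j + 1\<close>, and says that summing
  over the outcome of one more flip gives back the law of the earlier flips.\<close>

lemma half_rising_marginal:
  "half_rising (Suc i) * half_rising j / fact (Suc (i + j)) +
     half_rising i * half_rising (Suc j) / fact (Suc (i + j)) =
   half_rising i * half_rising j / fact (i + j)"
proof -
  have "half_rising (Suc i) * half_rising j + half_rising i * half_rising (Suc j) =
      half_rising i * half_rising j * real (Suc (i + j))"
    by (simp add: pochhammer_Suc algebra_simps)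
  then show ?thesis
    unfolding add_divide_distrib[symmetric] by (simp add: fact_Suc del: of_nat_Suc)
qed

text \<open>Only the block of \<open>X\<close> that contains \<open>i\<close> changes, so
  \<open>half_rising_marginal\<close> applies to one of the two factors.\<close>

lemma burnside_kernel_marginal:
  assumes fin: "finite B" and i: "i \<notin> B" and Y: "Y \<subseteq> B"
  shows "burnside_kernel (insert i B) X Y + burnside_kernel (insert i B) X (insert i Y) =
    burnside_kernel B X Y"
proof -
  have split: "card D = card (D - Y) + card (D \<inter> Y)" if "finite D" for D
    using that by (metis Int_Diff_Un card_Un_disjoint Diff_Int_distrib2 Int_Diff_disjoint
        add.commute finite_Diff finite_Int)
  let ?z = "B - X" and ?o = "B \<inter> X"
  define z0 z1 o0 o1 where "z0 = card (?z - Y)" and "z1 = card (?z \<inter> Y)"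
    and "o0 = card (?o - Y)" and "o1 = card (?o \<inter> Y)"
  note defs = z0_def[symmetric] z1_def[symmetric] o0_def[symmetric] o1_def[symmetric]
  let ?q = "\<lambda>a b m. half_rising a * half_rising b / fact m"
  have card_z: "card ?z = z0 + z1" and card_o: "card ?o = o0 + o1"
    using fin by (auto intro: split simp: z0_def z1_def o0_def o1_def)
  have rhs: "burnside_kernel B X Y = ?q z0 z1 (z0 + z1) * ?q o0 o1 (o0 + o1)"
    by (simp only: burnside_kernel_def card_z card_o defs)
  show ?thesis
  proof (cases "i \<in> X")
    case True
    have "insert i B - X = ?z" "insert i B \<inter> X = insert i ?o" "insert i ?o - Y = insert i (?o - Y)" "insert i ?o - insert i Y = ?o - Y"
      "insert i ?o \<inter> Y = ?o \<inter> Y" "insert i ?o \<inter> insert i Y = insert i (?o \<inter> Y)"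
      "?z - insert i Y = ?z - Y" "?z \<inter> insert i Y = ?z \<inter> Y"
      using i Y True by auto
    then have
      "burnside_kernel (insert i B) X Y = ?q z0 z1 (z0 + z1) * ?q (Suc o0) o1 (Suc (o0 + o1))"
      "burnside_kernel (insert i B) X (insert i Y) =
        ?q z0 z1 (z0 + z1) * ?q o0 (Suc o1) (Suc (o0 + o1))"
      unfolding burnside_kernel_def using i fin
      by (simp_all add: card_z card_o defs del: fact_Suc)
    then show ?thesis
      by (simp only: rhs half_rising_marginal[of o0 o1, symmetric] distrib_left)
  next
    case False
    have "insert i B - X = insert i ?z" "insert i B \<inter> X = ?o" "insert i ?z - Y = insert i (?z - Y)" "insert i ?z - insert i Y = ?z - Y"
      "insert i ?z \<inter> Y = ?z \<inter> Y" "insert i ?z \<inter> insert i Y = insert i (?z \<inter> Y)"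
      "?o - insert i Y = ?o - Y" "?o \<inter> insert i Y = ?o \<inter> Y"
      using i Y False by auto
    then have
      "burnside_kernel (insert i B) X Y = ?q (Suc z0) z1 (Suc (z0 + z1)) * ?q o0 o1 (o0 + o1)"
      "burnside_kernel (insert i B) X (insert i Y) =
        ?q z0 (Suc z1) (Suc (z0 + z1)) * ?q o0 o1 (o0 + o1)"
      unfolding burnside_kernel_def using i fin
      by (simp_all add: card_z card_o defs del: fact_Suc)
    then show ?thesis
      by (simp only: rhs half_rising_marginal[of z0 z1, symmetric] distrib_right)
  qed
qed

lemma sum_Pow_insert:
  assumes "finite B" "i \<notin> B"
  shows "(\<Sum>Y\<in>Pow (insert i B). f Y) = (\<Sum>Y\<in>Pow B. f Y + f (insert i Y))"
proof -
  have "inj_on (insert i) (Pow B)" using assms(2) by (auto simp: inj_on_def)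
  moreover have "Pow B \<inter> insert i ` Pow B = {}" using assms(2) by auto
  ultimately show ?thesis
    using assms(1) by (simp add: Pow_insert sum.union_disjoint sum.reindex sum.distrib)
qed

text \<open>\<open>walsh S\<close> does not see the coordinates outside \<open>S\<close>, so they
  are summed out one at a time. What remains depends on \<open>X\<close> only through
  \<open>X \<inter> S\<close>, which is the source of triangularity.\<close>

lemma burnside_kernel_walsh_restrict:
  assumes "finite A" and "S \<subseteq> A"
  shows "(\<Sum>Y\<in>Pow A. burnside_kernel A X Y * walsh S Y) =
    (\<Sum>Y\<in>Pow S. burnside_kernel S X Y * walsh S Y)"
proof -
  have finS: "finite S" using assms finite_subset by blast
  have "(\<Sum>Y\<in>Pow (S \<union> D). burnside_kernel (S \<union> D) X Y * walsh S Y) =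
      (\<Sum>Y\<in>Pow S. burnside_kernel S X Y * walsh S Y)"
    if "finite D" "D \<inter> S = {}" for D
    using that
  proof (induction D rule: finite_induct)
    case (insert i D)
    have fin: "finite (S \<union> D)" and i: "i \<notin> S \<union> D" using finS insert by auto
    have "(\<Sum>Y\<in>Pow (insert i (S \<union> D)). burnside_kernel (insert i (S \<union> D)) X Y * walsh S Y) =
        (\<Sum>Y\<in>Pow (S \<union> D). burnside_kernel (S \<union> D) X Y * walsh S Y)"
      unfolding sum_Pow_insert[OF fin i]
    proof (rule sum.cong[OF refl])
      fix Y assume Y: "Y \<in> Pow (S \<union> D)"
      have "walsh S (insert i Y) = walsh S Y"
        using i by (auto simp: walsh_def intro!: prod.cong)
      then show "burnside_kernel (insert i (S \<union> D)) X Y * walsh S Y +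
          burnside_kernel (insert i (S \<union> D)) X (insert i Y) * walsh S (insert i Y) =
          burnside_kernel (S \<union> D) X Y * walsh S Y"
        using burnside_kernel_marginal[OF fin i, of Y X] Y by (simp flip: distrib_right)
    qed
    then show ?case using insert by simp
  qed simp
  from this[of "A - S"] show ?thesis
    using assms finS by (simp add: Un_absorb1 Diff_disjoint Int_commute)
qed

lemma burnside_kernel_stochastic:
  assumes "finite A"
  shows "(\<Sum>Y\<in>Pow A. burnside_kernel A X Y) = 1"
  using burnside_kernel_walsh_restrict[OF assms, of "{}" X] by (simp add: burnside_kernel_def)

text \<open>Coefficient of \<open>walsh U\<close> in the image of \<open>walsh S\<close>. It is
  computed in the cube over \<open>S\<close> alone, so no ambient set enters; the value
  \<open>0\<close> off the subsets of \<open>S\<close> is the triangular shape.\<close>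

definition walsh_coeff :: "'a set \<Rightarrow> 'a set \<Rightarrow> real" where
  "walsh_coeff S U =
     (if U \<subseteq> S
      then (\<Sum>X\<in>Pow S. walsh U X * (\<Sum>Y\<in>Pow S. burnside_kernel S X Y * walsh S Y)) / 2 ^ card S
      else 0)"

lemma burnside_kernel_Int: "burnside_kernel S (X \<inter> S) Y = burnside_kernel S X Y"
proof -
  have "S - (X \<inter> S) = S - X" "S \<inter> (X \<inter> S) = S \<inter> X" by auto
  then show ?thesis by (simp add: burnside_kernel_def)
qed

text \<open>The image of \<open>walsh S\<close> is a function of \<open>X \<inter> S\<close>, so
  Fourier inversion inside the cube over \<open>S\<close> suffices and yields only index sets
  \<open>U \<subseteq> S\<close>.\<close>

lemma burnside_kernel_walsh:
  assumes "finite A" and "S \<subseteq> A"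
  shows "(\<Sum>Y\<in>Pow A. burnside_kernel A X Y * walsh S Y) =
    (\<Sum>U\<in>Pow A. walsh_coeff S U * walsh U X)"
proof -
  have finS: "finite S" using assms finite_subset by blast
  define h where "h = (\<lambda>X. \<Sum>Y\<in>Pow S. burnside_kernel S X Y * walsh S Y)"
  have coeff: "walsh_coeff S U = (\<Sum>Z\<in>Pow S. walsh U Z * h Z) / 2 ^ card S" if "U \<subseteq> S" for U
    using that by (simp add: walsh_coeff_def h_def)
  have "(\<Sum>U\<in>Pow A. walsh_coeff S U * walsh U X) = (\<Sum>U\<in>Pow S. walsh_coeff S U * walsh U X)"
    using assms by (intro sum.mono_neutral_right) (auto simp: walsh_coeff_def)
  also have "\<dots> = (\<Sum>U\<in>Pow S. walsh_coeff S U * walsh U (X \<inter> S))"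
    by (intro sum.cong refl arg_cong2[of _ _ _ _ "(*)"]) (auto simp: walsh_def intro!: prod.cong)
  also have "\<dots> = (\<Sum>U\<in>Pow S. \<Sum>Z\<in>Pow S. h Z / 2 ^ card S * (walsh U Z * walsh U (X \<inter> S)))"
    by (intro sum.cong)
      (simp_all add: coeff sum_divide_distrib sum_distrib_right sum_distrib_left ac_simps)
  also have "\<dots> = (\<Sum>Z\<in>Pow S. h Z / 2 ^ card S * (\<Sum>U\<in>Pow S. walsh U Z * walsh U (X \<inter> S)))"
    unfolding sum_distrib_left by (rule sum.swap)
  also have "\<dots> = (\<Sum>Z\<in>Pow S. if Z = X \<inter> S then h Z else 0)"
    by (intro sum.cong) (simp_all add: walsh_orthogonal[OF finS])
  also have "\<dots> = h (X \<inter> S)" using finS by simp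
  also have "\<dots> = h X" by (simp add: burnside_kernel_Int h_def)
  finally show ?thesis using burnside_kernel_walsh_restrict[OF assms] by (simp add: h_def)
qed

lemma sum_Pow_split:
  assumes "finite S" "X \<subseteq> S"
  shows "(\<Sum>Y\<in>Pow S. f (Y - X) (Y \<inter> X)) = (\<Sum>U\<in>Pow (S - X). \<Sum>V\<in>Pow X. f U V)"
proof -
  have "(\<Sum>Y\<in>Pow S. f (Y - X) (Y \<inter> X)) = (\<Sum>(U, V)\<in>Pow (S - X) \<times> Pow X. f U V)"
    by (rule sum.reindex_bij_witness[of _ "\<lambda>(U, V). U \<union> V" "\<lambda>Y. (Y - X, Y \<inter> X)"])
      (use assms in \<open>auto simp: Un_Diff Int_Un_distrib2\<close>)
  then show ?thesis by (simp add: sum.cartesian_product)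
qed

text \<open>For fixed \<open>X\<close> the blocks \<open>S - X\<close> and \<open>X\<close> are
  flipped by independent coins, so the image of \<open>walsh S\<close> at \<open>X\<close> is a
  product of two arcsine moments; the coefficient averages this product against the signs of
  \<open>walsh S\<close>.\<close>

lemma walsh_coeff_diagonal:
  assumes finS: "finite S"
  shows "walsh_coeff S S = burnside_eigenvalue (card S)"
proof -
  let ?t = "\<lambda>R Y. (-1) ^ card Y * (half_rising (card (R - Y)) * half_rising (card Y) / fact (card R))"
  have "walsh S X * (\<Sum>Y\<in>Pow S. burnside_kernel S X Y * walsh S Y) =
      (-1) ^ card X * (arcsine_moment (card (S - X)) * arcsine_moment (card X))"
    if X: "X \<in> Pow S" for X
  proof -
    have finX: "finite X" using X finS finite_subset by blast
    have "(\<Sum>Y\<in>Pow S. burnside_kernel S X Y * walsh S Y) =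
        (\<Sum>Y\<in>Pow S. ?t (S - X) (Y - X) * ?t X (Y \<inter> X))"
    proof (rule sum.cong[OF refl])
      fix Y assume Y: "Y \<in> Pow S"
      then have "finite Y" using finS finite_subset by blast
      then have "card Y = card (Y - X) + card (Y \<inter> X)"
        by (metis Int_Diff_Un Int_Diff_disjoint add.commute card_Un_disjoint finite_Diff finite_Int)
      moreover have "S - X - (Y - X) = S - X - Y" "(S - X) \<inter> Y = Y - X" "S \<inter> X = X"
        "X - Y \<inter> X = X - Y" "X \<inter> Y = Y \<inter> X" using X Y by auto
      ultimately show "burnside_kernel S X Y * walsh S Y = ?t (S - X) (Y - X) * ?t X (Y \<inter> X)"
        using Y finS by (simp add: burnside_kernel_def walsh_subset power_add)
    qed
    also have "\<dots> = (\<Sum>U\<in>Pow (S - X). ?t (S - X) U) * (\<Sum>V\<in>Pow X. ?t X V)"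
      using X finS by (simp only: PowD sum_Pow_split[of S X "\<lambda>U V. ?t (S - X) U * ?t X V"] sum_product)
    also have "\<dots> = arcsine_moment (card (S - X)) * arcsine_moment (card X)"
      using finS finX by (simp only: sum_signed_Pow_half_rising finite_Diff)
    finally show ?thesis using X finS by (simp add: walsh_subset)
  qed
  then have "walsh_coeff S S = (\<Sum>X\<in>Pow S. (-1) ^ card X *
      (arcsine_moment (card (S - X)) * arcsine_moment (card X))) / 2 ^ card S"
    by (simp add: walsh_coeff_def)
  then show ?thesis using sum_signed_Pow_arcsine_moment[OF finS] by simp
qed

section \<open>Powers of the kernel and their trace\<close>

primrec burnside_kernel_pow :: "'a set \<Rightarrow> nat \<Rightarrow> 'a set \<Rightarrow> 'a set \<Rightarrow> real" where
  "burnside_kernel_pow A 0 X Y = (if X = Y then 1 else 0)"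
| "burnside_kernel_pow A (Suc l) X Y =
    (\<Sum>Z\<in>Pow A. burnside_kernel A X Z * burnside_kernel_pow A l Z Y)"

text \<open>Row \<open>S\<close> holds the Walsh coefficients of the image of \<open>walsh S\<close>
  under \<open>l\<close> steps; one more step expands each \<open>walsh T\<close> in turn, hence the
  new factor on the right.\<close>

primrec walsh_coeff_pow :: "'a set \<Rightarrow> nat \<Rightarrow> 'a set \<Rightarrow> 'a set \<Rightarrow> real" where
  "walsh_coeff_pow A 0 S U = (if S = U then 1 else 0)"
| "walsh_coeff_pow A (Suc l) S U =
    (\<Sum>T\<in>Pow A. walsh_coeff_pow A l S T * walsh_coeff T U)"

lemma burnside_pow_eq_kernel_pow:
  assumes "x \<in> cube n" "y \<in> cube n"
  shows "burnside_pow n l x y = burnside_kernel_pow {..<n} l (ones n x) (ones n y)"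
  using assms(1)
proof (induction l arbitrary: x)
  case 0
  then show ?case
    using assms(2) inj_on_eq_iff[OF bij_betw_imp_inj_on[OF bij_betw_ones[of n]]] by auto
next
  case (Suc l)
  have "burnside_pow n (Suc l) x y = (\<Sum>z\<in>cube n. burnside_kernel {..<n} (ones n x) (ones n z) *
      burnside_kernel_pow {..<n} l (ones n z) (ones n y))"
    using Suc by (simp add: burnside_K_eq_kernel)
  also have "\<dots> = burnside_kernel_pow {..<n} (Suc l) (ones n x) (ones n y)"
    unfolding burnside_kernel_pow.simps by (rule sum.reindex_bij_betw[OF bij_betw_ones])
  finally show ?case .
qed

lemma burnside_kernel_pow_walsh:
  assumes "finite A" "S \<subseteq> A" "X \<subseteq> A"
  shows "(\<Sum>Y\<in>Pow A. burnside_kernel_pow A l X Y * walsh S Y) =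
    (\<Sum>U\<in>Pow A. walsh_coeff_pow A l S U * walsh U X)"
  using \<open>X \<subseteq> A\<close>
proof (induction l arbitrary: X)
  case 0
  have "(\<Sum>Y\<in>Pow A. burnside_kernel_pow A 0 X Y * walsh S Y) =
      (\<Sum>Y\<in>Pow A. if X = Y then walsh S Y else 0)" by (rule sum.cong) auto
  moreover have "(\<Sum>U\<in>Pow A. walsh_coeff_pow A 0 S U * walsh U X) =
      (\<Sum>U\<in>Pow A. if S = U then walsh U X else 0)" by (rule sum.cong) auto
  ultimately show ?case using assms 0 by simp
next
  case (Suc l)
  have "(\<Sum>Y\<in>Pow A. burnside_kernel_pow A (Suc l) X Y * walsh S Y) =
      (\<Sum>Y\<in>Pow A. \<Sum>Z\<in>Pow A. burnside_kernel A X Z * (burnside_kernel_pow A l Z Y * walsh S Y))"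
    by (simp add: sum_distrib_right mult.assoc)
  also have "\<dots> = (\<Sum>Z\<in>Pow A. burnside_kernel A X Z *
      (\<Sum>Y\<in>Pow A. burnside_kernel_pow A l Z Y * walsh S Y))"
    unfolding sum_distrib_left by (rule sum.swap)
  also have "\<dots> = (\<Sum>Z\<in>Pow A. \<Sum>T\<in>Pow A.
      walsh_coeff_pow A l S T * (burnside_kernel A X Z * walsh T Z))"
    using Suc.IH by (simp add: sum_distrib_left ac_simps)
  also have "\<dots> = (\<Sum>T\<in>Pow A. walsh_coeff_pow A l S T *
      (\<Sum>Z\<in>Pow A. burnside_kernel A X Z * walsh T Z))"
    unfolding sum_distrib_left by (rule sum.swap)
  also have "\<dots> = (\<Sum>T\<in>Pow A. \<Sum>U\<in>Pow A. walsh_coeff_pow A l S T * walsh_coeff T U * walsh U X)"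
    using burnside_kernel_walsh[OF \<open>finite A\<close>] by (simp add: sum_distrib_left mult.assoc)
  also have "\<dots> = (\<Sum>U\<in>Pow A. walsh_coeff_pow A (Suc l) S U * walsh U X)"
    unfolding walsh_coeff_pow.simps sum_distrib_right by (rule sum.swap)
  finally show ?case .
qed

lemma walsh_coeff_pow_triangular: "\<not> U \<subseteq> S \<Longrightarrow> walsh_coeff_pow A l S U = 0"
proof (induction l arbitrary: U)
  case (Suc l)
  have "walsh_coeff_pow A l S T * walsh_coeff T U = 0" for T
    using Suc by (cases "T \<subseteq> S") (auto simp: walsh_coeff_def)
  then show ?case unfolding walsh_coeff_pow.simps by (intro sum.neutral) blast
qed auto

lemma walsh_coeff_pow_diagonal:
  assumes "finite A" "S \<subseteq> A"
  shows "walsh_coeff_pow A l S S = burnside_eigenvalue (card S) ^ l"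
proof (induction l)
  case (Suc l)
  have "walsh_coeff_pow A l S T * walsh_coeff T S = 0" if "T \<noteq> S" for T
    using that walsh_coeff_pow_triangular[of T S A l] by (cases "T \<subseteq> S") (auto simp: walsh_coeff_def)
  then have "walsh_coeff_pow A (Suc l) S S = (\<Sum>T\<in>Pow A.
      if T = S then walsh_coeff_pow A l S S * walsh_coeff S S else 0)"
    by (auto intro!: sum.cong)
  also have "\<dots> = burnside_eigenvalue (card S) ^ Suc l"
    using assms Suc by (simp add: walsh_coeff_diagonal finite_subset)
  finally show ?case .
qed simp

text \<open>The trace is unchanged when computed in the Walsh basis, where the matrix power is
  triangular and its diagonal consists of powers of the diagonal entries. Orthogonality is used
  twice: over index sets to insert the basis, then over states to remove it.\<close>

lemma trace_burnside_kernel_pow: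
  assumes fin: "finite A" and "l \<ge> 1"
  shows "(\<Sum>X\<in>Pow A. burnside_kernel_pow A l X X) =
    (\<Sum>k\<le>card A div 2. real (card A choose (2 * k)) * burnside_eigenvalue (2 * k) ^ l)"
proof -
  have "(\<Sum>X\<in>Pow A. 2 ^ card A * burnside_kernel_pow A l X X) =
      (\<Sum>X\<in>Pow A. \<Sum>S\<in>Pow A. \<Sum>U\<in>Pow A. walsh_coeff_pow A l S U * (walsh S X * walsh U X))"
  proof (rule sum.cong[OF refl])
    fix X assume X: "X \<in> Pow A"
    have "2 ^ card A * burnside_kernel_pow A l X X =
        (\<Sum>Y\<in>Pow A. if Y = X then 2 ^ card A * burnside_kernel_pow A l X Y else 0)"
      using fin X by simp
    also have "\<dots> = (\<Sum>Y\<in>Pow A. burnside_kernel_pow A l X Y * (\<Sum>S\<in>Pow A. walsh S X * walsh S Y))"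
      using X by (intro sum.cong) (auto simp: walsh_orthogonal[OF fin])
    also have "\<dots> = (\<Sum>Y\<in>Pow A. \<Sum>S\<in>Pow A. walsh S X * (burnside_kernel_pow A l X Y * walsh S Y))"
      by (simp add: sum_distrib_left ac_simps)
    also have "\<dots> = (\<Sum>S\<in>Pow A. walsh S X * (\<Sum>Y\<in>Pow A. burnside_kernel_pow A l X Y * walsh S Y))"
      unfolding sum_distrib_left by (rule sum.swap)
    also have "\<dots> = (\<Sum>S\<in>Pow A. \<Sum>U\<in>Pow A. walsh_coeff_pow A l S U * (walsh S X * walsh U X))"
    proof (rule sum.cong[OF refl])
      fix S assume "S \<in> Pow A"
      then have "(\<Sum>Y\<in>Pow A. burnside_kernel_pow A l X Y * walsh S Y) =
          (\<Sum>U\<in>Pow A. walsh_coeff_pow A l S U * walsh U X)"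
        using X by (intro burnside_kernel_pow_walsh[OF fin]) auto
      then show "walsh S X * (\<Sum>Y\<in>Pow A. burnside_kernel_pow A l X Y * walsh S Y) =
          (\<Sum>U\<in>Pow A. walsh_coeff_pow A l S U * (walsh S X * walsh U X))"
        by (simp add: sum_distrib_left ac_simps)
    qed
    finally show "2 ^ card A * burnside_kernel_pow A l X X =
      (\<Sum>S\<in>Pow A. \<Sum>U\<in>Pow A. walsh_coeff_pow A l S U * (walsh S X * walsh U X))" .
  qed
  also have "\<dots> = (\<Sum>S\<in>Pow A. \<Sum>X\<in>Pow A. \<Sum>U\<in>Pow A. walsh_coeff_pow A l S U * (walsh S X * walsh U X))"
    by (rule sum.swap)
  also have "\<dots> = (\<Sum>S\<in>Pow A. \<Sum>U\<in>Pow A. \<Sum>X\<in>Pow A. walsh_coeff_pow A l S U * (walsh S X * walsh U X))"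
    by (rule sum.cong[OF refl], rule sum.swap)
  also have "\<dots> = (\<Sum>S\<in>Pow A. \<Sum>U\<in>Pow A. if S = U then 2 ^ card A * walsh_coeff_pow A l S U else 0)"
  proof (intro sum.cong refl)
    fix S U assume SU: "S \<in> Pow A" "U \<in> Pow A"
    have "walsh S X = walsh X S" "walsh U X = walsh X U" if "X \<in> Pow A" for X
      using that SU walsh_commute[OF fin] by blast+
    then have "(\<Sum>X\<in>Pow A. walsh_coeff_pow A l S U * (walsh S X * walsh U X)) =
        walsh_coeff_pow A l S U * (\<Sum>X\<in>Pow A. walsh X S * walsh X U)"
      unfolding sum_distrib_left by (intro sum.cong refl arg_cong2[of _ _ _ _ "(*)"])
    then show "(\<Sum>X\<in>Pow A. walsh_coeff_pow A l S U * (walsh S X * walsh U X)) =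
        (if S = U then 2 ^ card A * walsh_coeff_pow A l S U else 0)"
      using SU by (simp add: walsh_orthogonal[OF fin])
  qed
  also have "\<dots> = 2 ^ card A * (\<Sum>S\<in>Pow A. burnside_eigenvalue (card S) ^ l)"
    using fin by (simp add: sum_distrib_left walsh_coeff_pow_diagonal)
  finally have "(\<Sum>X\<in>Pow A. burnside_kernel_pow A l X X) =
      (\<Sum>S\<in>Pow A. burnside_eigenvalue (card S) ^ l)"
    by (simp flip: sum_distrib_left)
  also have "\<dots> = (\<Sum>j\<le>card A. real (card A choose j) * burnside_eigenvalue j ^ l)"
    by (rule sum_Pow_card[OF fin])
  \<comment> \<open>The bound \<open>l \<ge> 1\<close> matters here: for odd \<open>j\<close> the
    eigenvalue is \<open>0\<close>, and \<open>0 ^ 0\<close> would be \<open>1\<close>.\<close>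
  also have "\<dots> = (\<Sum>j\<in>(\<lambda>k. 2 * k) ` {..card A div 2}. real (card A choose j) * burnside_eigenvalue j ^ l)"
  proof (rule sum.mono_neutral_right)
    show "\<forall>j\<in>{..card A} - (\<lambda>k. 2 * k) ` {..card A div 2}.
        real (card A choose j) * burnside_eigenvalue j ^ l = 0"
    proof
      fix j assume j: "j \<in> {..card A} - (\<lambda>k. 2 * k) ` {..card A div 2}"
      have "odd j"
      proof
        assume "even j"
        then have "j = 2 * (j div 2)" "j div 2 \<le> card A div 2" using j by (auto intro: div_le_mono)
        then show False using j by blast
      qed
      then show "real (card A choose j) * burnside_eigenvalue j ^ l = 0"
        using \<open>l \<ge> 1\<close> by (simp add: burnside_eigenvalue_def)
    qed
  qed auto
  also have "\<dots> = (\<Sum>k\<le>card A div 2. real (card A choose (2 * k)) * burnside_eigenvalue (2 * k) ^ l)"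
    by (simp add: sum.reindex inj_on_def)
  finally show ?thesis .
qed

section \<open>The chi-square distance as a return probability\<close>

definition subset_stat :: "'a set \<Rightarrow> 'a set \<Rightarrow> real" where
  "subset_stat A X = 1 / (real (card A + 1) * real (card A choose card X))"

definition subset_chi2 :: "'a set \<Rightarrow> 'a set \<Rightarrow> nat \<Rightarrow> real" where
  "subset_chi2 A X l =
     (\<Sum>Y\<in>Pow A. (burnside_kernel_pow A l X Y - subset_stat A Y)\<^sup>2 / subset_stat A Y)"

lemma stat_dist_eq: "stat_dist n x = subset_stat {..<n} (ones n x)"
  by (simp add: stat_dist_def subset_stat_def weight_def ones_def)

lemma chi2_eq:
  assumes "x \<in> cube n"
  shows "chi2 n x l = subset_chi2 {..<n} (ones n x) l"
proof -
  let ?X = "ones n x"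
  have "chi2 n x l = (\<Sum>y\<in>cube n. (burnside_kernel_pow {..<n} l ?X (ones n y) -
      subset_stat {..<n} (ones n y))\<^sup>2 / subset_stat {..<n} (ones n y))"
    unfolding chi2_def using assms
    by (intro sum.cong refl) (simp add: burnside_pow_eq_kernel_pow stat_dist_eq)
  also have "\<dots> = subset_chi2 {..<n} ?X l"
    unfolding subset_chi2_def by (rule sum.reindex_bij_betw[OF bij_betw_ones])
  finally show ?thesis .
qed

lemma chi2_avg_eq: "chi2_avg n l = (\<Sum>X\<in>Pow {..<n}. subset_stat {..<n} X * subset_chi2 {..<n} X l)"
proof -
  have "chi2_avg n l =
      (\<Sum>x\<in>cube n. subset_stat {..<n} (ones n x) * subset_chi2 {..<n} (ones n x) l)"
    unfolding chi2_avg_def by (intro sum.cong refl) (simp add: chi2_eq stat_dist_eq)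
  also have "\<dots> = (\<Sum>X\<in>Pow {..<n}. subset_stat {..<n} X * subset_chi2 {..<n} X l)"
    by (rule sum.reindex_bij_betw[OF bij_betw_ones])
  finally show ?thesis .
qed

lemma subset_stat_pos:
  assumes "finite A" "X \<subseteq> A"
  shows "subset_stat A X > 0"
  using assms by (simp add: subset_stat_def card_mono)

lemma sum_subset_stat:
  assumes "finite A"
  shows "(\<Sum>X\<in>Pow A. subset_stat A X) = 1"
proof -
  have "(\<Sum>X\<in>Pow A. subset_stat A X) =
      (\<Sum>j\<le>card A. real (card A choose j) * (1 / (real (card A + 1) * real (card A choose j))))"
    unfolding subset_stat_def by (rule sum_Pow_card[OF assms])
  also have "\<dots> = (\<Sum>j\<le>card A. 1 / real (card A + 1))" by (rule sum.cong) auto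
  finally show ?thesis by simp
qed

text \<open>The factorials in the kernel cancel against the binomial coefficient in the stationary
  mass. In the remaining product, exchanging \<open>X\<close> and \<open>Y\<close> only exchanges
  the classes \<open>(A - X) \<inter> Y\<close> and \<open>A \<inter> X - Y\<close>.\<close>

lemma burnside_kernel_reversible:
  assumes "finite A" "X \<subseteq> A" "Y \<subseteq> A"
  shows "subset_stat A X * burnside_kernel A X Y = subset_stat A Y * burnside_kernel A Y X"
proof -
  let ?N = "\<lambda>X Y. half_rising (card (A - X - Y)) * half_rising (card ((A - X) \<inter> Y)) *
    (half_rising (card (A \<inter> X - Y)) * half_rising (card (A \<inter> X \<inter> Y))) / (real (card A + 1) * fact (card A))"
  have stat_kernel: "subset_stat A X * burnside_kernel A X Y = ?N X Y" if "X \<subseteq> A" for X Y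
  proof -
    have "card (A - X) = card A - card X" "card X \<le> card A" "A \<inter> X = X"
      using that assms(1) by (auto simp: card_Diff_subset finite_subset card_mono)
    then show ?thesis
      by (simp add: subset_stat_def burnside_kernel_def binomial_fact del: of_nat_add of_nat_Suc)
  qed
  have "A - Y - X = A - X - Y" "(A - Y) \<inter> X = A \<inter> X - Y" "A \<inter> Y - X = (A - X) \<inter> Y"
    "A \<inter> Y \<inter> X = A \<inter> X \<inter> Y" by auto
  then have "?N X Y = ?N Y X" by (simp add: ac_simps)
  then show ?thesis using assms by (simp add: stat_kernel)
qed

lemma burnside_kernel_pow_add:
  assumes "finite A" "X \<subseteq> A"
  shows "burnside_kernel_pow A (l + m) X Y =
    (\<Sum>Z\<in>Pow A. burnside_kernel_pow A l X Z * burnside_kernel_pow A m Z Y)"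
  using \<open>X \<subseteq> A\<close>
proof (induction l arbitrary: X)
  case 0
  have "(\<Sum>Z\<in>Pow A. burnside_kernel_pow A 0 X Z * burnside_kernel_pow A m Z Y) =
      (\<Sum>Z\<in>Pow A. if X = Z then burnside_kernel_pow A m Z Y else 0)" by (rule sum.cong) auto
  then show ?case using assms(1) 0 by simp
next
  case (Suc l)
  have "burnside_kernel_pow A (Suc l + m) X Y = (\<Sum>W\<in>Pow A. \<Sum>Z\<in>Pow A.
      burnside_kernel A X W * burnside_kernel_pow A l W Z * burnside_kernel_pow A m Z Y)"
    using Suc.IH by (simp add: sum_distrib_left mult.assoc)
  also have "\<dots> = (\<Sum>Z\<in>Pow A. burnside_kernel_pow A (Suc l) X Z * burnside_kernel_pow A m Z Y)"
    unfolding burnside_kernel_pow.simps sum_distrib_right by (rule sum.swap)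
  finally show ?case .
qed

lemma burnside_kernel_pow_reversible:
  assumes "finite A" "X \<subseteq> A" "Y \<subseteq> A"
  shows "subset_stat A X * burnside_kernel_pow A l X Y = subset_stat A Y * burnside_kernel_pow A l Y X"
  using assms(2,3)
proof (induction l arbitrary: X Y)
  case (Suc l)
  have one: "burnside_kernel_pow A (Suc 0) Z X = burnside_kernel A Z X" if "Z \<subseteq> A" for Z
  proof -
    have "burnside_kernel_pow A (Suc 0) Z X =
        (\<Sum>W\<in>Pow A. if W = X then burnside_kernel A Z W else 0)"
      by (auto intro!: sum.cong)
    then show ?thesis using assms(1) Suc.prems by simp
  qed
  have "subset_stat A X * burnside_kernel_pow A (Suc l) X Y =
      (\<Sum>Z\<in>Pow A. subset_stat A X * burnside_kernel A X Z * burnside_kernel_pow A l Z Y)"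
    by (simp add: sum_distrib_left mult.assoc)
  also have "\<dots> = (\<Sum>Z\<in>Pow A. (subset_stat A Z * burnside_kernel_pow A l Z Y) * burnside_kernel A Z X)"
    using Suc.prems by (intro sum.cong refl)
      (simp add: burnside_kernel_reversible[OF assms(1), of X] ac_simps)
  also have "\<dots> = (\<Sum>Z\<in>Pow A. subset_stat A Y *
      (burnside_kernel_pow A l Y Z * burnside_kernel_pow A (Suc 0) Z X))"
    using Suc by (intro sum.cong refl) (simp add: one del: burnside_kernel_pow.simps)
  also have "\<dots> = subset_stat A Y * burnside_kernel_pow A (l + Suc 0) Y X"
    using Suc.prems assms(1) by (simp only: burnside_kernel_pow_add sum_distrib_left)
  finally show ?case by (simp only: add_Suc_right add_0_right)
qed auto

lemma burnside_kernel_pow_stochastic: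
  assumes "finite A" "X \<subseteq> A"
  shows "(\<Sum>Y\<in>Pow A. burnside_kernel_pow A l X Y) = 1"
  using assms(2)
proof (induction l arbitrary: X)
  case 0
  then show ?case using assms(1) by simp
next
  case (Suc l)
  have "(\<Sum>Y\<in>Pow A. burnside_kernel_pow A (Suc l) X Y) =
      (\<Sum>Z\<in>Pow A. burnside_kernel A X Z * (\<Sum>Y\<in>Pow A. burnside_kernel_pow A l Z Y))"
    unfolding burnside_kernel_pow.simps sum_distrib_left by (rule sum.swap)
  also have "\<dots> = 1" using Suc.IH burnside_kernel_stochastic[OF assms(1)] by simp
  finally show ?case .
qed

text \<open>Expand the square. Reversibility turns the quadratic term into a path from
  \<open>X\<close> to \<open>Y\<close> and back, which sums to a return in \<open>2 * l\<close>
  steps; the other two terms contribute \<open>-2\<close> and \<open>1\<close>.\<close>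

lemma subset_chi2_return:
  assumes fin: "finite A" and X: "X \<subseteq> A"
  shows "subset_chi2 A X l = burnside_kernel_pow A (2 * l) X X / subset_stat A X - 1"
proof -
  let ?K = "burnside_kernel_pow A l" and ?p = "subset_stat A"
  have px: "?p X > 0" by (rule subset_stat_pos[OF fin X])
  have "(?K X Y - ?p Y)\<^sup>2 / ?p Y = ?K X Y * ?K Y X / ?p X - 2 * ?K X Y + ?p Y" if Y: "Y \<subseteq> A" for Y
  proof -
    have py: "?p Y > 0" by (rule subset_stat_pos[OF fin Y])
    have "(?K X Y - ?p Y)\<^sup>2 / ?p Y = ?K X Y * (?K X Y / ?p Y) - 2 * ?K X Y + ?p Y"
      using py by (simp add: power2_eq_square field_simps)
    also have "?K X Y / ?p Y = ?K Y X / ?p X"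
      using burnside_kernel_pow_reversible[OF fin X Y, of l] px py by (simp add: field_simps)
    finally show ?thesis by simp
  qed
  then have "subset_chi2 A X l = (\<Sum>Y\<in>Pow A. ?K X Y * ?K Y X / ?p X - 2 * ?K X Y + ?p Y)"
    unfolding subset_chi2_def by (intro sum.cong refl) auto
  also have "\<dots> = (\<Sum>Y\<in>Pow A. ?K X Y * ?K Y X) / ?p X - 2 * (\<Sum>Y\<in>Pow A. ?K X Y) + (\<Sum>Y\<in>Pow A. ?p Y)"
    by (simp add: sum.distrib sum_subtractf sum_distrib_left sum_divide_distrib)
  also have "\<dots> = burnside_kernel_pow A (l + l) X X / ?p X - 1"
    using fin X
    by (simp add: burnside_kernel_pow_add burnside_kernel_pow_stochastic sum_subset_stat)
  finally show ?thesis by (simp add: mult_2)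
qed

lemma chi2_avg_formula:
  assumes "l \<ge> 1"
  shows "chi2_avg n l =
    (\<Sum>k = 1..n div 2. real (n choose (2 * k)) * burnside_eigenvalue (2 * k) ^ (2 * l))"
proof -
  let ?f = "\<lambda>k. real (n choose (2 * k)) * burnside_eigenvalue (2 * k) ^ (2 * l)"
  have "chi2_avg n l = (\<Sum>X\<in>Pow {..<n}. burnside_kernel_pow {..<n} (2 * l) X X - subset_stat {..<n} X)"
    unfolding chi2_avg_eq
  proof (rule sum.cong[OF refl])
    fix X assume X: "X \<in> Pow {..<n}"
    then have "subset_stat {..<n} X > 0" by (intro subset_stat_pos) auto
    then show "subset_stat {..<n} X * subset_chi2 {..<n} X l =
        burnside_kernel_pow {..<n} (2 * l) X X - subset_stat {..<n} X"
      using X by (simp add: subset_chi2_return field_simps)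
  qed
  also have "\<dots> = (\<Sum>k\<le>n div 2. ?f k) - 1"
    using assms by (simp add: sum_subtractf sum_subset_stat trace_burnside_kernel_pow)
  \<comment> \<open>The term \<open>k = 0\<close>, the eigenvalue \<open>1\<close> of the constant
    function, cancels the subtracted \<open>1\<close>.\<close>
  also have "{..n div 2} = insert 0 {1..n div 2}" by auto
  also have "(\<Sum>k\<in>insert 0 {1..n div 2}. ?f k) = ?f 0 + (\<Sum>k = 1..n div 2. ?f k)"
    by (rule sum.insert) auto
  also have "?f 0 = 1" by (simp add: burnside_eigenvalue_def)
  finally show ?thesis by simp
qed

section \<open>Invariance under relabelling the coordinates\<close>

lemma burnside_kernel_pow_bij:
  assumes f: "bij_betw f A A" and fin: "finite A" and "X \<subseteq> A" "Y \<subseteq> A"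
  shows "burnside_kernel_pow A l (f ` X) (f ` Y) = burnside_kernel_pow A l X Y"
proof -
  have inj: "inj_on f A" and im: "f ` A = A" using f by (auto simp: bij_betw_def)
  have kernel: "burnside_kernel A (f ` X) (f ` Y) = burnside_kernel A X Y"
    if "X \<subseteq> A" "Y \<subseteq> A" for X Y
  proof -
    have diff: "f ` C - f ` D = f ` (C - D)" if "C \<subseteq> A" "D \<subseteq> A" for C D
      using inj_on_image_set_diff[OF inj] that by auto
    have int: "f ` C \<inter> f ` D = f ` (C \<inter> D)" if "C \<subseteq> A" "D \<subseteq> A" for C D
      using inj_on_image_Int[OF inj] that by auto
    have card: "card (f ` C) = card C" if "C \<subseteq> A" for C
      using card_image[OF inj_on_subset[OF inj that]] .
    have sub: "A - X \<subseteq> A" "A \<inter> X \<subseteq> A" by auto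
    have "A - f ` X = f ` (A - X)" "A \<inter> f ` X = f ` (A \<inter> X)"
      using diff[of A X] int[of A X] that im by auto
    moreover have "A - X - Y \<subseteq> A" "(A - X) \<inter> Y \<subseteq> A" "A \<inter> X - Y \<subseteq> A" "A \<inter> X \<inter> Y \<subseteq> A" by auto
    ultimately show ?thesis
      unfolding burnside_kernel_def
      by (simp only: diff[OF sub(1) that(2)] diff[OF sub(2) that(2)]
          int[OF sub(1) that(2)] int[OF sub(2) that(2)] card sub)
  qed
  have bij: "bij_betw ((`) f) (Pow A) (Pow A)" by (rule bij_betw_Pow[OF f])
  show ?thesis
    using \<open>X \<subseteq> A\<close>
  proof (induction l arbitrary: X)
    case 0
    then show ?case using inj_on_image_eq_iff[OF inj] \<open>Y \<subseteq> A\<close> by simp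
  next
    case (Suc l)
    have "burnside_kernel_pow A (Suc l) (f ` X) (f ` Y) =
        (\<Sum>Z\<in>Pow A. burnside_kernel A (f ` X) (f ` Z) * burnside_kernel_pow A l (f ` Z) (f ` Y))"
      by (simp add: sum.reindex_bij_betw[OF bij, of "\<lambda>Z. burnside_kernel A (f ` X) Z *
            burnside_kernel_pow A l Z (f ` Y)"])
    also have "\<dots> = burnside_kernel_pow A (Suc l) X Y"
      using Suc by (simp add: kernel)
    finally show ?case .
  qed
qed

text \<open>Bijections from \<open>X\<close> to \<open>Y\<close> and between their complements
  combine to a permutation of \<open>A\<close>, under which return probabilities are
  invariant.\<close>

lemma subset_chi2_card_cong:
  assumes fin: "finite A" and X: "X \<subseteq> A" and Y: "Y \<subseteq> A" and card: "card X = card Y"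
  shows "subset_chi2 A X l = subset_chi2 A Y l"
proof -
  have finXY: "finite X" "finite Y" using fin X Y finite_subset by blast+
  obtain g where g: "bij_betw g X Y" using finXY card finite_same_card_bij by blast
  have "card (A - X) = card (A - Y)" using finXY X Y card by (simp add: card_Diff_subset)
  then obtain h where h: "bij_betw h (A - X) (A - Y)" using fin finite_same_card_bij by blast
  let ?f = "\<lambda>i. if i \<in> X then g i else h i"
  have "bij_betw ?f (X \<union> (A - X)) (Y \<union> (A - Y))"
    by (rule bij_betw_disjoint_Un[OF g h]) auto
  moreover have "X \<union> (A - X) = A" "Y \<union> (A - Y) = A" using X Y by auto
  ultimately have f: "bij_betw ?f A A" by simp
  have "?f ` X = Y" using bij_betw_imp_surj_on[OF g] by auto
  then have "burnside_kernel_pow A (2 * l) Y Y = burnside_kernel_pow A (2 * l) X X"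
    using burnside_kernel_pow_bij[OF f fin X X, of "2 * l"] by (simp only:)
  then show ?thesis using X Y fin card by (simp add: subset_chi2_return subset_stat_def)
qed

lemma subset_chi2_nonneg:
  assumes "finite A"
  shows "subset_chi2 A X l \<ge> 0"
  unfolding subset_chi2_def
  using subset_stat_pos[OF assms] by (intro sum_nonneg divide_nonneg_pos) auto

lemma chi2_nonneg: "x \<in> cube n \<Longrightarrow> chi2 n x l \<ge> 0"
  by (simp add: chi2_eq subset_chi2_nonneg)

text \<open>The distance depends on the starting weight only, and each weight has stationary mass
  \<open>1/(n+1)\<close>.\<close>

lemma chi2_le_chi2_avg:
  assumes x: "x \<in> cube n"
  shows "chi2 n x l \<le> real (n + 1) * chi2_avg n l"
proof -
  let ?A = "{..<n}"
  let ?X = "ones n x"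
  have X: "?X \<subseteq> ?A" by (rule ones_subset)
  then have w: "card ?X \<le> n" using card_mono[OF _ X] by simp
  let ?C = "{Y. Y \<subseteq> ?A \<and> card Y = card ?X}"
  have "chi2 n x l / real (n + 1) =
      (\<Sum>Y\<in>?C. subset_chi2 ?A ?X l / (real (n + 1) * real (n choose card ?X)))"
    using x w n_subsets[of ?A "card ?X"] by (simp add: chi2_eq)
  also have "\<dots> = (\<Sum>Y\<in>?C. subset_stat ?A Y * subset_chi2 ?A Y l)"
  proof (rule sum.cong[OF refl])
    fix Y assume Y: "Y \<in> ?C"
    then have "subset_chi2 ?A Y l = subset_chi2 ?A ?X l"
      using X by (intro subset_chi2_card_cong) auto
    then show "subset_chi2 ?A ?X l / (real (n + 1) * real (n choose card ?X)) =
        subset_stat ?A Y * subset_chi2 ?A Y l"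
      using Y by (simp add: subset_stat_def)
  qed
  also have "\<dots> \<le> chi2_avg n l"
    unfolding chi2_avg_eq
  proof (rule sum_mono2)
    fix Y assume "Y \<in> Pow ?A - ?C"
    then show "0 \<le> subset_stat ?A Y * subset_chi2 ?A Y l"
      using subset_stat_pos[of ?A Y] subset_chi2_nonneg[of ?A Y l] by simp
  qed auto
  finally show ?thesis by (simp add: field_simps)
qed

lemma chi2_avg_nonneg: "chi2_avg n l \<ge> 0"
  unfolding chi2_avg_def by (intro sum_nonneg mult_nonneg_nonneg) (auto simp: chi2_nonneg stat_dist_def)

section \<open>Lower bounds\<close>

lemma half_rising_over_fact_Suc:
  "half_rising (Suc m) / fact (Suc m) = half_rising m / fact m * ((2 * real m + 1) / (2 * real m + 2))"
  by (simp add: pochhammer_Suc field_simps)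

text \<open>The constants \<open>4\<close> and \<open>1\<close> make the bound exact at
  \<open>m = 0\<close> and barely inductive: the two sides of the cleared inequality differ by
  \<open>1\<close>. They also fit the mean inequality used for the holding probability.\<close>

lemma half_rising_over_fact_lower: "1 / (4 * real m + 1) \<le> (half_rising m / fact m)\<^sup>2"
proof (induction m)
  case (Suc m)
  have "1 / (4 * real (Suc m) + 1) \<le> 1 / (4 * real m + 1) * ((2 * real m + 1) / (2 * real m + 2))\<^sup>2"
  proof -
    have "(4 * real m + 1) * (2 * real m + 2)\<^sup>2 \<le> (4 * real (Suc m) + 1) * (2 * real m + 1)\<^sup>2"
      by (simp add: power2_eq_square algebra_simps)
    then show ?thesis
      by (simp add: power_divide divide_simps) (simp add: power2_eq_square algebra_simps)
  qed
  also have "\<dots> \<le> (half_rising m / fact m)\<^sup>2 * ((2 * real m + 1) / (2 * real m + 2))\<^sup>2"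
    by (rule mult_right_mono[OF Suc]) simp
  finally show ?case by (simp only: half_rising_over_fact_Suc power_mult_distrib)
qed simp

lemma half_rising_over_fact_upper: "(half_rising m / fact m)\<^sup>2 \<le> 1 / (2 * real m + 1)"
proof (induction m)
  case (Suc m)
  have "(half_rising m / fact m)\<^sup>2 * ((2 * real m + 1) / (2 * real m + 2))\<^sup>2 \<le>
      1 / (2 * real m + 1) * ((2 * real m + 1) / (2 * real m + 2))\<^sup>2"
    by (rule mult_right_mono[OF Suc]) simp
  also have "\<dots> = (2 * real m + 1) / (2 * real m + 2)\<^sup>2"
  proof -
    have "0 < 2 * real m + 1" by (simp add: add_nonneg_pos)
    then show ?thesis by (simp add: power_divide power2_eq_square)
  qed
  also have "\<dots> \<le> 1 / (2 * real (Suc m) + 1)"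
  proof -
    have "(2 * real m + 1) * (2 * real (Suc m) + 1) \<le> (2 * real m + 2)\<^sup>2"
      by (simp add: power2_eq_square algebra_simps)
    then show ?thesis by (simp add: divide_simps)
  qed
  finally show ?case by (simp only: half_rising_over_fact_Suc power_mult_distrib)
qed simp

lemma burnside_eigenvalue_bounds:
  "0 \<le> burnside_eigenvalue (2 * k)" "burnside_eigenvalue (2 * k) \<le> 1 / (2 * real k + 1)"
  using half_rising_over_fact_upper[of k] by (simp_all add: burnside_eigenvalue_def)

lemma half_rising_nonneg: "0 \<le> half_rising m"
  by (rule less_imp_le, rule pochhammer_pos) simp

lemma burnside_kernel_nonneg: "0 \<le> burnside_kernel A X Y"
  unfolding burnside_kernel_def
  by (intro mult_nonneg_nonneg divide_nonneg_nonneg half_rising_nonneg) auto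

lemma burnside_kernel_pow_nonneg: "0 \<le> burnside_kernel_pow A l X Y"
  by (induction l arbitrary: X) (auto intro!: sum_nonneg mult_nonneg_nonneg burnside_kernel_nonneg)

text \<open>Staying put means that each block receives a constant pattern, so the holding
  probability is a product of two ratios \<open>half_rising m / fact m\<close>. Their bounds concern
  squares, hence the comparison of squares.\<close>

lemma burnside_kernel_diagonal_lower:
  assumes fin: "finite A" and X: "X \<subseteq> A"
  shows "1 / (2 * real (card A) + 1) \<le> burnside_kernel A X X"
proof (rule power2_le_imp_le)
  let ?z = "card (A - X)" and ?o = "card X"
  have n: "real (card A) = real ?z + real ?o"
    using card_Diff_subset[OF finite_subset[OF X fin] X] card_mono[OF fin X] by simp
  have "A - X - X = A - X" "(A - X) \<inter> X = {}" "A \<inter> X - X = {}" "A \<inter> X \<inter> X = X" "A \<inter> X = X"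
    using X by auto
  then have K: "burnside_kernel A X X = half_rising ?z / fact ?z * (half_rising ?o / fact ?o)"
    by (simp add: burnside_kernel_def)
  \<comment> \<open>Arithmetic-geometric mean: \<open>4 z + 1\<close> and \<open>4 o + 1\<close>
    with \<open>z + o = n\<close> have mean \<open>2 n + 1\<close>.\<close>
  have "(4 * real ?z + 1) * (4 * real ?o + 1) \<le> (2 * real (card A) + 1)\<^sup>2"
    using zero_le_power2[of "real ?z - real ?o"] unfolding n
    by (simp add: power2_eq_square algebra_simps)
  moreover have "0 < (4 * real ?z + 1) * (4 * real ?o + 1)"
    by (intro mult_pos_pos add_nonneg_pos) auto
  ultimately have "(1 / (2 * real (card A) + 1))\<^sup>2 \<le> 1 / ((4 * real ?z + 1) * (4 * real ?o + 1))"
    by (simp add: power_divide frac_le)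
  also have "\<dots> = 1 / (4 * real ?z + 1) * (1 / (4 * real ?o + 1))" by simp
  also have "\<dots> \<le> (half_rising ?z / fact ?z)\<^sup>2 * (half_rising ?o / fact ?o)\<^sup>2"
    by (intro mult_mono half_rising_over_fact_lower) auto
  finally show "(1 / (2 * real (card A) + 1))\<^sup>2 \<le> (burnside_kernel A X X)\<^sup>2"
    by (simp only: K power_mult_distrib)
qed (rule burnside_kernel_nonneg)

lemma burnside_kernel_pow_diagonal_lower:
  assumes fin: "finite A" and X: "X \<subseteq> A"
  shows "(1 / (2 * real (card A) + 1)) ^ l \<le> burnside_kernel_pow A l X X"
proof (induction l)
  case (Suc l)
  have "(1 / (2 * real (card A) + 1)) ^ Suc l \<le> burnside_kernel A X X * burnside_kernel_pow A l X X"
    unfolding power_Suc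
    by (intro mult_mono burnside_kernel_diagonal_lower assms Suc burnside_kernel_nonneg) simp
  also have "\<dots> \<le> burnside_kernel_pow A (Suc l) X X"
    unfolding burnside_kernel_pow.simps
    using fin X
    by (intro member_le_sum[where f = "\<lambda>Z. burnside_kernel A X Z * burnside_kernel_pow A l Z X"])
      (auto intro!: mult_nonneg_nonneg burnside_kernel_nonneg burnside_kernel_pow_nonneg)
  finally show ?case .
qed simp

lemma chi2_lower:
  assumes x: "x \<in> cube n"
  shows "real (n + 1) * real (n choose weight n x) / (2 * real n + 1) ^ (2 * l) - 1 \<le> chi2 n x l"
proof -
  have w: "card (ones n x) = weight n x" by (simp add: ones_def weight_def)
  have "(1 / (2 * real n + 1)) ^ (2 * l) \<le>
      burnside_kernel_pow {..<n} (2 * l) (ones n x) (ones n x)"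
    using burnside_kernel_pow_diagonal_lower[OF _ ones_subset, of n "2 * l" x] by simp
  then have "(1 / (2 * real n + 1)) ^ (2 * l) * (real (n + 1) * real (n choose weight n x)) \<le>
      burnside_kernel_pow {..<n} (2 * l) (ones n x) (ones n x) *
      (real (n + 1) * real (n choose weight n x))"
    by (rule mult_right_mono) simp
  then show ?thesis
    using x ones_subset[of n x]
    by (simp add: chi2_eq subset_chi2_return subset_stat_def w power_divide)
qed

text \<open>Staying at the starting state for all \<open>2 l\<close> steps already has probability at least
  \<open>(2 n + 1)\<^sup>-\<^sup>2\<^sup>l\<close>, which beats an exponentially small stationary probability.\<close>

lemma chi2_over_n_at_top:
  fixes l :: "nat \<Rightarrow> nat"
  assumes ev: "\<forall>\<^sub>F n in sequentially. x n \<in> cube n \<and>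
      exp (b * real n) \<le> real (n + 1) * real (n choose weight n (x n))"
    and l: "\<forall>n\<ge>2. real (l n) \<le> \<kappa> * (real n / ln (real n))"
    and "2 * \<kappa> < b"
  shows "filterlim (\<lambda>n. chi2 n (x n) (l n) / real (n + 1)) at_top sequentially"
proof -
  \<comment> \<open>Half of the exponential margin is kept; the other half pays for
    \<open>ln (2 n + 1)\<close> standing in place of \<open>ln n\<close>, a ratio that tends to
    \<open>1\<close>.\<close>
  define \<eta> where "\<eta> = (b - 2 * \<kappa>) / 2"
  have eta: "\<eta> > 0" using assms(3) by (simp add: \<eta>_def)
  have "(\<lambda>n. ln (2 * real n + 1) / ln (real n)) \<longlonglongrightarrow> 1" by real_asymp
  then have "(\<lambda>n. b - 2 * \<kappa> * (ln (2 * real n + 1) / ln (real n))) \<longlonglongrightarrow> b - 2 * \<kappa> * 1"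
    by (intro tendsto_intros)
  then have "\<forall>\<^sub>F n in sequentially. b - 2 * \<kappa> * (ln (2 * real n + 1) / ln (real n)) > \<eta>"
    by (rule order_tendstoD(1)) (use eta in \<open>simp add: \<eta>_def\<close>)
  then have "\<forall>\<^sub>F n in sequentially. (exp (\<eta> * real n) - 1) / real (n + 1) \<le>
      chi2 n (x n) (l n) / real (n + 1)"
    using ev eventually_ge_at_top[of 2]
  proof eventually_elim
    case (elim n)
    have "2 * real (l n) * ln (2 * real n + 1) \<le> 2 * (\<kappa> * (real n / ln (real n))) * ln (2 * real n + 1)"
      using l elim by (intro mult_right_mono mult_left_mono) auto
    also have "\<dots> = real n * (2 * \<kappa> * (ln (2 * real n + 1) / ln (real n)))" by simp
    also have "\<dots> \<le> real n * (b - \<eta>)" using elim by (intro mult_left_mono) auto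
    finally have "exp (\<eta> * real n) \<le> exp (b * real n - 2 * real (l n) * ln (2 * real n + 1))"
      by (simp add: algebra_simps)
    also have "\<dots> = exp (b * real n) / (2 * real n + 1) ^ (2 * l n)"
    proof -
      have "exp (2 * real (l n) * ln (2 * real n + 1)) = exp (ln (2 * real n + 1)) ^ (2 * l n)"
        using exp_of_nat_mult[of "2 * l n" "ln (2 * real n + 1)"] by simp
      also have "exp (ln (2 * real n + 1)) = 2 * real n + 1"
        by (rule exp_ln) (simp add: add_nonneg_pos)
      finally show ?thesis by (simp add: exp_diff)
    qed
    also have "\<dots> \<le> real (n + 1) * real (n choose weight n (x n)) / (2 * real n + 1) ^ (2 * l n)"
      using elim by (intro divide_right_mono) auto
    finally have "exp (\<eta> * real n) - 1 \<le> chi2 n (x n) (l n)"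
      using chi2_lower[of "x n" n "l n"] elim by linarith
    then show ?case by (intro divide_right_mono) auto
  qed
  moreover have "filterlim (\<lambda>n. (exp (\<eta> * real n) - 1) / real (n + 1)) at_top sequentially"
    using eta by real_asymp
  ultimately show ?thesis by (rule filterlim_at_top_mono[rotated])
qed

text \<open>The form divided by \<open>n + 1\<close> is the stronger one; it is carried along
  because \<open>chi2_le_chi2_avg\<close> transfers it to the average.\<close>

lemma chi2_at_top:
  assumes "filterlim (\<lambda>n. chi2 n (x n) (l n) / real (n + 1)) at_top sequentially"
    and "\<forall>n\<ge>2. x n \<in> cube n"
  shows "filterlim (\<lambda>n. chi2 n (x n) (l n)) at_top sequentially"
proof (rule filterlim_at_top_mono[OF assms(1)])
  show "\<forall>\<^sub>F n in sequentially. chi2 n (x n) (l n) / real (n + 1) \<le> chi2 n (x n) (l n)"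
    using eventually_ge_at_top[of 2]
  proof eventually_elim
    case (elim n)
    then have "0 \<le> chi2 n (x n) (l n)" using assms(2) by (simp add: chi2_nonneg)
    then show ?case by (simp add: divide_le_eq algebra_simps)
  qed
qed

section \<open>Starting states of exponentially small stationary mass\<close>

lemma half_state_cube: "half_state n \<in> cube n"
  by (auto simp: half_state_def cube_def)

lemma weight_half_state: "weight n (half_state n) = n - n div 2"
proof -
  have "{i \<in> {..<n}. half_state n i = 1} = {n div 2..<n}"
    by (auto simp: half_state_def split: if_splits)
  then show ?thesis by (simp add: weight_def)
qed

lemma two_pow_le_central_binomial: "2 ^ n \<le> (n + 1) * (n choose (n div 2))"
proof -
  have "2 ^ n = (\<Sum>k\<le>n. n choose k)" by (simp add: choose_row_sum)
  also have "\<dots> \<le> (\<Sum>k\<le>n. n choose (n div 2))" by (rule sum_mono) (rule binomial_maximum)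
  finally show ?thesis by simp
qed

text \<open>The stationary mass at half weight is at most \<open>2^-n\<close>, so
  \<open>b = ln 2\<close> is admissible, and the requirement \<open>2 * \<kappa> < b\<close> reduces
  to \<open>\<epsilon> > 0\<close>.\<close>

lemma chi2_half_state_over_n_at_top:
  fixes l :: "nat \<Rightarrow> nat"
  assumes "\<epsilon> > 0"
    and "\<forall>n\<ge>2. real (l n) \<le> (1 - \<epsilon>) * (ln 2 / 2) * (real n / ln (real n))"
  shows "filterlim (\<lambda>n. chi2 n (half_state n) (l n) / real (n + 1)) at_top sequentially"
proof (rule chi2_over_n_at_top)
  have "exp (ln 2 * real n) \<le> real (n + 1) * real (n choose weight n (half_state n))" for n
  proof -
    have "exp (ln 2 * real n) = 2 ^ n"
      by (simp add: mult.commute exp_of_nat_mult)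
    also have "\<dots> \<le> real (n + 1) * real (n choose (n div 2))"
      using two_pow_le_central_binomial[of n] by (metis of_nat_le_iff of_nat_mult of_nat_numeral of_nat_power)
    also have "n choose (n div 2) = n choose weight n (half_state n)"
      unfolding weight_half_state by (rule binomial_symmetric) simp
    finally show ?thesis .
  qed
  then show "\<forall>\<^sub>F n in sequentially. half_state n \<in> cube n \<and>
      exp (ln 2 * real n) \<le> real (n + 1) * real (n choose weight n (half_state n))"
    by (simp add: half_state_cube)
  show "2 * ((1 - \<epsilon>) * (ln 2 / 2)) < ln 2"
    using assms(1) by (simp add: algebra_simps)
qed (rule assms(2))

text \<open>By symmetry \<open>w\<close> may be replaced by \<open>j\<close>, which lies between
  \<open>c n\<close> and \<open>n / 2\<close>; then \<open>(n / j)^j\<close> is at least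
  \<open>2^j\<close>.\<close>

lemma binomial_ge_exp:
  assumes "w \<le> n" "c > 0" "n > 0" "c * real n \<le> real w" "real w \<le> (1 - c) * real n"
  shows "exp (c * ln 2 * real n) \<le> real (n choose w)"
proof -
  define j where "j = min w (n - w)"
  have j: "c * real n \<le> real j" "2 * j \<le> n"
    using assms by (auto simp: j_def min_def of_nat_diff algebra_simps)
  have "j > 0" using j(1) assms(2,3) by (metis gr0I mult_pos_pos not_less of_nat_0 of_nat_0_less_iff)
  have "n choose j = n choose w"
    using assms(1) binomial_symmetric[of w n] by (simp add: j_def min_def)
  have "exp (c * ln 2 * real n) \<le> exp (real j * ln 2)"
    using mult_right_mono[OF j(1), of "ln 2"] by (simp add: ac_simps)
  also have "\<dots> = 2 ^ j" by (simp add: exp_of_nat_mult)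
  also have "\<dots> \<le> (real n / real j) ^ j"
    using \<open>j > 0\<close> j(2) by (intro power_mono) (simp_all add: le_divide_eq flip: of_nat_mult)
  also have "\<dots> \<le> real (n choose j)"
    using j(2) by (intro binomial_ge_n_over_k_pow_k) simp
  finally show ?thesis using \<open>n choose j = n choose w\<close> by simp
qed

lemma weight_le: "weight n x \<le> n"
  using card_mono[of "{..<n}" "{i \<in> {..<n}. x i = 1}"] by (auto simp: weight_def)

lemma chi2_balanced_over_n_at_top:
  fixes l :: "nat \<Rightarrow> nat"
  assumes "c > 0" and x: "\<forall>n\<ge>2. x n \<in> cube n"
    and balanced: "\<forall>\<^sub>F n in sequentially. c * real n \<le> real (weight n (x n)) \<and>
      real (weight n (x n)) \<le> (1 - c) * real n"
    and "\<forall>n\<ge>2. real (l n) \<le> c * ln 2 / 4 * (real n / ln (real n))"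
  shows "filterlim (\<lambda>n. chi2 n (x n) (l n) / real (n + 1)) at_top sequentially"
proof (rule chi2_over_n_at_top)
  show "\<forall>\<^sub>F n in sequentially. x n \<in> cube n \<and>
      exp (c * ln 2 * real n) \<le> real (n + 1) * real (n choose weight n (x n))"
    using balanced eventually_ge_at_top[of 2]
  proof eventually_elim
    case (elim n)
    have "exp (c * ln 2 * real n) \<le> real (n choose weight n (x n))"
      using elim \<open>c > 0\<close> by (intro binomial_ge_exp weight_le) auto
    also have "\<dots> \<le> real (n + 1) * real (n choose weight n (x n))"
      using mult_right_mono[of 1 "real (n + 1)" "real (n choose weight n (x n))"] by simp
    finally show ?case using x elim by simp
  qed
  \<comment> \<open>With \<open>b = c * ln 2\<close>, any \<open>\<kappa>\<close> below
    \<open>c * ln 2 / 2\<close> is admissible; half of that bound is taken.\<close>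
  show "2 * (c * ln 2 / 4) < c * ln 2" using \<open>c > 0\<close> by simp
qed (rule assms(4))

section \<open>Upper bounds\<close>

text \<open>Eigenvalues with \<open>2 k + 1 \<ge> n\<^sup>1\<^sup>-\<^sup>\<delta>\<close> are so small that their power kills the factor
  \<open>2\<^sup>n\<close>; the other ones have multiplicity only \<open>exp (o(n / ln n))\<close>.\<close>

lemma chi2_avg_term_le:
  fixes \<epsilon> :: real
  defines "\<delta> \<equiv> \<epsilon> / (2 * (1 + \<epsilon>))"
  assumes "\<epsilon> > 0" and n: "n \<ge> 2" and k: "1 \<le> k" "2 * k \<le> n"
    and l: "real l \<ge> (1 + \<epsilon>) * (ln 2 / 2) * (real n / ln (real n))"
  shows "real (n choose (2 * k)) * burnside_eigenvalue (2 * k) ^ (2 * l) \<le>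
    exp (- (\<epsilon> / 2 * ln 2 * real n)) +
    exp (real n powr (1 - \<delta>) * ln (real n) - (ln 2)\<^sup>2 * (real n / ln (real n)))"
proof -
  have lnn: "ln (real n) > 0" using n by simp
  \<comment> \<open>\<open>\<delta>\<close> is chosen so that lowering the eigenvalue threshold from
    \<open>n\<close> to \<open>n^(1-\<delta>)\<close> spends half of the slack
    \<open>\<epsilon>\<close> and leaves the other half.\<close>
  have delta: "(1 + \<epsilon>) * (1 - \<delta>) = 1 + \<epsilon> / 2" "1 - \<delta> > 0"
    using \<open>\<epsilon> > 0\<close> by (simp_all add: \<delta>_def field_simps)
  have pow: "burnside_eigenvalue (2 * k) ^ (2 * l) \<le> exp (- (2 * real l * t))"
    if "exp t \<le> 2 * real k + 1" for t
  proof -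
    have "burnside_eigenvalue (2 * k) \<le> 1 / (2 * real k + 1)" by (rule burnside_eigenvalue_bounds)
    also have "\<dots> \<le> 1 / exp t" using that by (intro divide_left_mono) auto
    also have "\<dots> = exp (- t)" by (simp add: exp_minus inverse_eq_divide)
    finally have "burnside_eigenvalue (2 * k) ^ (2 * l) \<le> exp (- t) ^ (2 * l)"
      by (rule power_mono) (rule burnside_eigenvalue_bounds)
    also have "\<dots> = exp (- (2 * real l * t))" by (simp flip: exp_of_nat_mult)
    finally show ?thesis .
  qed
  show ?thesis
  proof (cases "real n powr (1 - \<delta>) \<le> 2 * real k + 1")
    \<comment> \<open>The eigenvalue power is at most \<open>2^(-(1 + \<epsilon>/2) n)\<close>,
      which outweighs the multiplicity bound \<open>2^n\<close>.\<close>
    case True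
    have "real (n choose (2 * k)) \<le> 2 ^ n"
      by (metis binomial_le_pow2 of_nat_le_iff of_nat_numeral of_nat_power)
    also have "\<dots> = exp (real n * ln 2)" by (simp add: exp_of_nat_mult)
    finally have mult: "real (n choose (2 * k)) \<le> exp (real n * ln 2)" .
    have "exp ((1 - \<delta>) * ln (real n)) \<le> 2 * real k + 1" using True n by (simp add: powr_def)
    then have "real (n choose (2 * k)) * burnside_eigenvalue (2 * k) ^ (2 * l) \<le>
        exp (real n * ln 2) * exp (- (2 * real l * ((1 - \<delta>) * ln (real n))))"
      by (intro mult_mono mult pow) (auto simp: burnside_eigenvalue_bounds)
    also have "\<dots> \<le> exp (- (\<epsilon> / 2 * ln 2 * real n))"
    proof -
      have "(1 + \<epsilon> / 2) * ln 2 * real n =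
          2 * ((1 + \<epsilon>) * (ln 2 / 2) * (real n / ln (real n))) * ((1 - \<delta>) * ln (real n))"
        using lnn by (simp flip: delta(1))
      also have "\<dots> \<le> 2 * real l * ((1 - \<delta>) * ln (real n))"
        using l lnn delta(2) by (intro mult_right_mono mult_left_mono) auto
      finally show ?thesis by (simp add: algebra_simps flip: exp_add)
    qed
    finally show ?thesis by (meson add_increasing2 exp_ge_zero)
  next
    case False
    have "real (n choose (2 * k)) \<le> real n ^ (2 * k)"
      using binomial_le_pow[OF k(2)] by (metis of_nat_le_iff of_nat_power)
    also have "\<dots> = exp (real (2 * k) * ln (real n))"
      using n by (simp add: exp_of_nat_mult del: of_nat_mult)
    also have "\<dots> \<le> exp (real n powr (1 - \<delta>) * ln (real n))"
      using False lnn by simp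
    finally have mult: "real (n choose (2 * k)) \<le> exp (real n powr (1 - \<delta>) * ln (real n))" .
    \<comment> \<open>Here the crude eigenvalue bound \<open>1/2\<close>, valid because
      \<open>k \<ge> 1\<close>, suffices: its power decays like
      \<open>exp (- const * n / ln n)\<close>, while the multiplicity exponent
      \<open>n^(1-\<delta>) ln n\<close> is of lower order.\<close>
    have "exp (ln 2) \<le> 2 * real k + 1" using k(1) by simp
    then have "real (n choose (2 * k)) * burnside_eigenvalue (2 * k) ^ (2 * l) \<le>
        exp (real n powr (1 - \<delta>) * ln (real n)) * exp (- (2 * real l * ln 2))"
      by (intro mult_mono mult pow) (auto simp: burnside_eigenvalue_bounds)
    also have "\<dots> \<le> exp (real n powr (1 - \<delta>) * ln (real n) - (ln 2)\<^sup>2 * (real n / ln (real n)))"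
    proof -
      have "(ln 2)\<^sup>2 * (real n / ln (real n)) = 2 * (1 * (ln 2 / 2) * (real n / ln (real n))) * ln 2"
        by (simp add: power2_eq_square)
      also have "\<dots> \<le> 2 * ((1 + \<epsilon>) * (ln 2 / 2) * (real n / ln (real n))) * ln 2"
        using \<open>\<epsilon> > 0\<close> lnn by (intro mult_right_mono mult_left_mono) auto
      also have "\<dots> \<le> 2 * real l * ln 2"
        using l by (intro mult_right_mono mult_left_mono) auto
      finally show ?thesis by (simp flip: exp_add)
    qed
    finally show ?thesis by (meson add_increasing exp_ge_zero)
  qed
qed

text \<open>The factor \<open>n + 1\<close> prepares for \<open>chi2_le_chi2_avg\<close>. It and the
  number of summands, at most \<open>n\<close>, are absorbed because \<open>?B\<close> decays faster
  than every power of \<open>n\<close>.\<close>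

lemma n_chi2_avg_tendsto_0:
  fixes l :: "nat \<Rightarrow> nat"
  assumes eps: "\<epsilon> > 0"
    and l: "\<forall>n\<ge>2. real (l n) \<ge> (1 + \<epsilon>) * (ln 2 / 2) * (real n / ln (real n))"
  shows "(\<lambda>n. real (n + 1) * chi2_avg n (l n)) \<longlonglongrightarrow> 0"
proof -
  define \<delta> where "\<delta> = \<epsilon> / (2 * (1 + \<epsilon>))"
  define \<eta> where "\<eta> = \<epsilon> / 2 * ln 2"
  have pos: "\<delta> > 0" "\<delta> < 1" "\<eta> > 0" using eps by (simp_all add: \<delta>_def \<eta>_def field_simps)
  let ?B = "\<lambda>n. exp (- (\<eta> * real n)) +
    exp (real n powr (1 - \<delta>) * ln (real n) - (ln 2)\<^sup>2 * (real n / ln (real n)))"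
  have upper: "\<forall>\<^sub>F n in sequentially.
      real (n + 1) * chi2_avg n (l n) \<le> real (n + 1) * (real n * ?B n)"
    using eventually_ge_at_top[of 2]
  proof eventually_elim
    case (elim n)
    \<comment> \<open>Positivity of the lower bound forces \<open>l n \<ge> 1\<close>, which the
      eigenvalue formula requires.\<close>
    have "0 < (1 + \<epsilon>) * (ln 2 / 2) * (real n / ln (real n))"
      using elim eps by (intro mult_pos_pos divide_pos_pos) auto
    also have "\<dots> \<le> real (l n)" using l elim by blast
    finally have "l n \<ge> 1" by simp
    then have "chi2_avg n (l n) = (\<Sum>k = 1..n div 2. real (n choose (2 * k)) * burnside_eigenvalue (2 * k) ^ (2 * l n))"
      by (rule chi2_avg_formula)
    also have "\<dots> \<le> (\<Sum>k = 1..n div 2. ?B n)"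
      using chi2_avg_term_le[OF eps elim] l elim unfolding \<delta>_def \<eta>_def
      by (intro sum_mono) auto
    also have "\<dots> = real (n div 2) * ?B n" by simp
    also have "\<dots> \<le> real n * ?B n" by (intro mult_right_mono add_nonneg_nonneg) auto
    finally show ?case by (intro mult_left_mono) auto
  qed
  have lim: "(\<lambda>n. real (n + 1) * (real n * ?B n)) \<longlonglongrightarrow> 0"
    using pos by real_asymp
  have "\<forall>\<^sub>F n in sequentially. 0 \<le> real (n + 1) * chi2_avg n (l n)"
    using chi2_avg_nonneg by simp
  then show ?thesis by (rule tendsto_sandwich[OF _ upper tendsto_const lim])
qed

lemma chi2_avg_tendsto_0:
  fixes l :: "nat \<Rightarrow> nat"
  assumes "(\<lambda>n. real (n + 1) * chi2_avg n (l n)) \<longlonglongrightarrow> 0"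
  shows "(\<lambda>n. chi2_avg n (l n)) \<longlonglongrightarrow> 0"
proof (rule tendsto_sandwich[OF _ _ tendsto_const assms])
  show "\<forall>\<^sub>F n in sequentially. chi2_avg n (l n) \<le> real (n + 1) * chi2_avg n (l n)"
    using chi2_avg_nonneg by (auto intro!: always_eventually simp: algebra_simps)
qed (simp add: chi2_avg_nonneg)

lemma chi2_tendsto_0:
  fixes l :: "nat \<Rightarrow> nat"
  assumes "(\<lambda>n. real (n + 1) * chi2_avg n (l n)) \<longlonglongrightarrow> 0" and x: "\<forall>n\<ge>2. x n \<in> cube n"
  shows "(\<lambda>n. chi2 n (x n) (l n)) \<longlonglongrightarrow> 0"
proof (rule tendsto_sandwich[OF _ _ tendsto_const assms(1)])
  show "\<forall>\<^sub>F n in sequentially. 0 \<le> chi2 n (x n) (l n)"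
    using eventually_ge_at_top[of 2] by eventually_elim (use x in \<open>simp add: chi2_nonneg\<close>)
  show "\<forall>\<^sub>F n in sequentially. chi2 n (x n) (l n) \<le> real (n + 1) * chi2_avg n (l n)"
    using eventually_ge_at_top[of 2] by eventually_elim (use x chi2_le_chi2_avg in blast)
qed

text \<open>The average is bounded below by its part at half weight and not by the eigenvalue
  formula, so the case \<open>l n = 0\<close>, where that formula fails for
  \<open>n \<ge> 1\<close>, is covered as well.\<close>

lemma chi2_avg_at_top:
  assumes "filterlim (\<lambda>n. chi2 n (half_state n) (l n) / real (n + 1)) at_top sequentially"
  shows "filterlim (\<lambda>n. chi2_avg n (l n)) at_top sequentially"
proof (rule filterlim_at_top_mono[OF assms])
  have "chi2 n (half_state n) (l n) / real (n + 1) \<le> chi2_avg n (l n)" for n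
    using chi2_le_chi2_avg[OF half_state_cube, of n "l n"] by (simp add: divide_le_eq mult.commute)
  then show "\<forall>\<^sub>F n in sequentially. chi2 n (half_state n) (l n) / real (n + 1) \<le> chi2_avg n (l n)"
    by simp
qed

theorem theorem1p1:
  shows
  "(\<forall>(n::nat) (l::nat). n \<ge> 1 \<longrightarrow> l \<ge> 1 \<longrightarrow>
      chi2_avg n l =
        (\<Sum>k = 1..n div 2. real (n choose (2 * k)) *
            (1 / 2 ^ (4 * k) * (real ((2 * k) choose k))\<^sup>2) ^ (2 * l))) \<and>
   (\<forall>\<epsilon>::real. \<epsilon> > 0 \<longrightarrow>
      (\<forall>l::nat \<Rightarrow> nat.
         (\<forall>n\<ge>2. real (l n) \<le> (1 - \<epsilon>) * (ln 2 / 2) * (real n / ln (real n))) \<longrightarrow>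
         filterlim (\<lambda>n. chi2_avg n (l n)) at_top sequentially) \<and>
      (\<forall>l::nat \<Rightarrow> nat.
         (\<forall>n\<ge>2. real (l n) \<ge> (1 + \<epsilon>) * (ln 2 / 2) * (real n / ln (real n))) \<longrightarrow>
         (\<lambda>n. chi2_avg n (l n)) \<longlonglongrightarrow> 0) \<and>
      (\<exists>x. (\<forall>n\<ge>2. x n \<in> cube n) \<and>
         (\<forall>l::nat \<Rightarrow> nat.
            (\<forall>n\<ge>2. real (l n) \<le> (1 - \<epsilon>) * (ln 2 / 2) * (real n / ln (real n))) \<longrightarrow>
            filterlim (\<lambda>n. chi2 n (x n) (l n)) at_top sequentially)) \<and>
      (\<forall>x. (\<forall>n\<ge>2. x n \<in> cube n) \<longrightarrow>
         (\<forall>l::nat \<Rightarrow> nat.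
            (\<forall>n\<ge>2. real (l n) \<ge> (1 + \<epsilon>) * (ln 2 / 2) * (real n / ln (real n))) \<longrightarrow>
            (\<lambda>n. chi2 n (x n) (l n)) \<longlonglongrightarrow> 0))) \<and>
   (\<forall>c::real. 0 < c \<and> c < 1 \<longrightarrow>
      (\<exists>\<kappa>::real. \<kappa> > 0 \<and>
        (\<forall>x. (\<forall>n\<ge>2. x n \<in> cube n) \<longrightarrow>
          (\<forall>\<^sub>F n in sequentially.
             c * real n \<le> real (weight n (x n)) \<and>
             real (weight n (x n)) \<le> (1 - c) * real n) \<longrightarrow>
          (\<forall>l::nat \<Rightarrow> nat. (\<forall>n\<ge>2. real (l n) \<le> \<kappa> * (real n / ln (real n))) \<longrightarrow>
             filterlim (\<lambda>n. chi2 n (x n) (l n)) at_top sequentially)))) \<and>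
   (\<forall>\<epsilon>::real. \<epsilon> > 0 \<longrightarrow>
      (\<forall>l::nat \<Rightarrow> nat.
         (\<forall>n\<ge>2. real (l n) \<le> (1 - \<epsilon>) * (ln 2 / 2) * (real n / ln (real n))) \<longrightarrow>
         filterlim (\<lambda>n. chi2 n (half_state n) (l n)) at_top sequentially))"
proof (intro conjI allI impI)
  fix n l :: nat assume "l \<ge> 1"
  then show "chi2_avg n l = (\<Sum>k = 1..n div 2. real (n choose (2 * k)) *
      (1 / 2 ^ (4 * k) * (real ((2 * k) choose k))\<^sup>2) ^ (2 * l))"
    by (simp only: chi2_avg_formula burnside_eigenvalue_even)
next
  fix \<epsilon> :: real and l :: "nat \<Rightarrow> nat"
  assume "\<epsilon> > 0" "\<forall>n\<ge>2. real (l n) \<le> (1 - \<epsilon>) * (ln 2 / 2) * (real n / ln (real n))"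
  then show "filterlim (\<lambda>n. chi2_avg n (l n)) at_top sequentially"
    and "filterlim (\<lambda>n. chi2 n (half_state n) (l n)) at_top sequentially"
    by (intro chi2_avg_at_top chi2_at_top chi2_half_state_over_n_at_top; simp add: half_state_cube)+
next
  fix \<epsilon> :: real and l :: "nat \<Rightarrow> nat"
  assume *: "\<epsilon> > 0" "\<forall>n\<ge>2. real (l n) \<ge> (1 + \<epsilon>) * (ln 2 / 2) * (real n / ln (real n))"
  show "(\<lambda>n. chi2_avg n (l n)) \<longlonglongrightarrow> 0"
    by (rule chi2_avg_tendsto_0[OF n_chi2_avg_tendsto_0[OF *]])
  show "(\<lambda>n. chi2 n (x n) (l n)) \<longlonglongrightarrow> 0" if "\<forall>n\<ge>2. x n \<in> cube n" for x
    by (rule chi2_tendsto_0[OF n_chi2_avg_tendsto_0[OF *] that])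
next
  \<comment> \<open>The witness is \<open>half_state\<close>, one sequence that serves every
    \<open>l\<close> and every \<open>\<epsilon>\<close>.\<close>
  fix \<epsilon> :: real assume "\<epsilon> > 0"
  then show "\<exists>x. (\<forall>n\<ge>2. x n \<in> cube n) \<and>
      (\<forall>l::nat \<Rightarrow> nat.
        (\<forall>n\<ge>2. real (l n) \<le> (1 - \<epsilon>) * (ln 2 / 2) * (real n / ln (real n))) \<longrightarrow>
        filterlim (\<lambda>n. chi2 n (x n) (l n)) at_top sequentially)"
    using chi2_at_top[OF chi2_half_state_over_n_at_top] half_state_cube by blast
next
  fix c :: real assume "0 < c \<and> c < 1"
  then have "c > 0" by simp
  then show "\<exists>\<kappa>::real. \<kappa> > 0 \<and>
      (\<forall>x. (\<forall>n\<ge>2. x n \<in> cube n) \<longrightarrow>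
        (\<forall>\<^sub>F n in sequentially.
           c * real n \<le> real (weight n (x n)) \<and>
           real (weight n (x n)) \<le> (1 - c) * real n) \<longrightarrow>
        (\<forall>l::nat \<Rightarrow> nat. (\<forall>n\<ge>2. real (l n) \<le> \<kappa> * (real n / ln (real n))) \<longrightarrow>
           filterlim (\<lambda>n. chi2 n (x n) (l n)) at_top sequentially))"
    using chi2_at_top[OF chi2_balanced_over_n_at_top] by (intro exI[of _ "c * ln 2 / 4"]) simp
qed

end
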